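(* Define groups $L_0=\mathbb Z$ and $L_{k+1}=L_k\wr_X\Gamma$ for $k\ge0$, where $\Gamma$ is the first Grigorchuk group and $X=\rho\Gamma$. Then $v_{L_k}(n)\sim\exp\big(\log(n)\,n^{1-(1-\alpha)^k}\big)$ for every $k$.
   Context: The first Grigorchuk group $\Gamma$ is the group of permutations of $\{0,1\}^{\mathbb N}$ (acting on the right) generated by $a,b,c,d$, defined recursively for $x\in\{0,1\}$ and infinite binary sequences $u$ by: $(xu)a=(1-x)u$; $(0u)b=0(ua)$, $(1u)b=1(uc)$; $(0u)c=0(ua)$, $(1u)c=1(ud)$; $(0u)d=0u$, $(1u)d=1(ub)$. Let $\rho=111\cdots$ and $X=\rho\Gamma$ its orbit. Let $\eta$ be the real root of $t^3+t^2+t-2$ and $\alpha=\log2/\log(2/\eta)$. For groups $A,G$ with $G$ acting on the right on $X$, $A\wr_XG=(\bigoplus_XA)\rtimes G$, where $\bigoplus_XA$ is the group of finitely supported functions $X\to A$ and $(g\cdot f)(x)=f(xg)$. Growth functions are counted with respect to finite generating sets; $g\preceq f$ if $g(n)\le f(Cn)$ for some $C>0$ and all large $n$, and $f\sim g$ if $f\preceq g\preceq f$. *)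

theory Defs
  imports Complex_Main "HOL-Algebra.Generated_Groups"
begin

text \<open>Infinite binary sequences: True encodes the letter 1, False the letter 0.
  Group elements are functions on sequences; since the action is on the right,
  the product g h (first g, then h) is the function composition h o g.\<close>

type_synonym seq = "nat \<Rightarrow> bool"

datatype gen = GA | GB | GC | GD

text \<open>Successor in the cycle b -> c -> d -> b (the state reached after reading a 1).\<close>
fun nxt :: "gen \<Rightarrow> gen" where
  "nxt GB = GC" | "nxt GC = GD" | "nxt GD = GB" | "nxt GA = GA"

text \<open>Closed form of the recursive definition:
  (xu)a = (1-x)u; for s in {b,c,d}, s reads the maximal prefix 1^i of ones, its
  state cycles b->c->d->b, and at the first 0 (position i) it applies a to the
  remaining tail (flips position i+1) iff the current state is b or c; the
  sequence 111... is fixed.\<close>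
definition gen_act :: "gen \<Rightarrow> seq \<Rightarrow> seq" where
  "gen_act s u =
     (if s = GA then u(0 := \<not> u 0)
      else if (\<forall>j. u j) then u
      else (let i = (LEAST j. \<not> u j); st = (nxt ^^ i) s in
            if st = GD then u else u(Suc i := \<not> u (Suc i))))"

inductive_set Grig :: "(seq \<Rightarrow> seq) set" where
  Grig_id: "id \<in> Grig"
| Grig_gen: "gen_act s \<in> Grig"
| Grig_mult: "g \<in> Grig \<Longrightarrow> h \<in> Grig \<Longrightarrow> h \<circ> g \<in> Grig"
| Grig_inv: "g \<in> Grig \<Longrightarrow> inv_into UNIV g \<in> Grig"

definition rho :: seq where "rho = (\<lambda>_. True)"

definition Xorb :: "seq set" where "Xorb = (\<lambda>g. g rho) ` Grig"

text \<open>A universe containing all elements of all L_k: an integer (element of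
  L_0 = Z), or a pair (f, g) with f : X -> L_k finitely supported and g in Gamma.\<close>
datatype W = ZEl int | WEl "seq \<Rightarrow> W" "seq \<Rightarrow> seq"

fun zv :: "W \<Rightarrow> int" where
  "zv (ZEl a) = a" | "zv (WEl f g) = 0"

fun wfun :: "W \<Rightarrow> seq \<Rightarrow> W" where
  "wfun (WEl f g) = f" | "wfun (ZEl a) = (\<lambda>_. ZEl 0)"

fun wperm :: "W \<Rightarrow> seq \<Rightarrow> seq" where
  "wperm (WEl f g) = g" | "wperm (ZEl a) = id"

text \<open>L_0 = Z, and L_{k+1} = L_k wr_X Gamma = (finitely supported X -> L_k) x| Gamma with
  (f1,g1)(f2,g2) = (f1 (g1 . f2), g1 g2), where (g . f)(x) = f(x g).
  Functions are normalised to the identity outside X.\<close>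
primrec L :: "nat \<Rightarrow> W monoid" where
  "L 0 = \<lparr>carrier = range ZEl, mult = (\<lambda>p q. ZEl (zv p + zv q)), one = ZEl 0\<rparr>"
| "L (Suc k) =
     \<lparr>carrier = {WEl f g | f g. g \<in> Grig
                   \<and> (\<forall>x\<in>Xorb. f x \<in> carrier (L k))
                   \<and> (\<forall>x. x \<notin> Xorb \<longrightarrow> f x = one (L k))
                   \<and> finite {x \<in> Xorb. f x \<noteq> one (L k)}},
      mult = (\<lambda>p q. WEl (\<lambda>x. if x \<in> Xorb
                                then mult (L k) (wfun p x) (wfun q (wperm p x))
                                else one (L k))
                         (wperm q \<circ> wperm p)),
      one = WEl (\<lambda>_. one (L k)) id\<rparr>"

definition ball :: "('a, 'b) monoid_scheme \<Rightarrow> 'a set \<Rightarrow> nat \<Rightarrow> 'a set" where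
  "ball G S n = {foldr (mult G) ws (one G) | ws.
                   length ws \<le> n \<and> set ws \<subseteq> S \<union> (m_inv G ` S)}"

definition growth :: "('a, 'b) monoid_scheme \<Rightarrow> 'a set \<Rightarrow> real \<Rightarrow> real" where
  "growth G S x = real (card (ball G S (nat \<lfloor>x\<rfloor>)))"

definition preceq :: "(real \<Rightarrow> real) \<Rightarrow> (real \<Rightarrow> real) \<Rightarrow> bool" where
  "preceq g f \<longleftrightarrow> (\<exists>C>0. \<forall>\<^sub>F n in sequentially. g (real n) \<le> f (C * real n))"

definition growth_equiv :: "(real \<Rightarrow> real) \<Rightarrow> (real \<Rightarrow> real) \<Rightarrow> bool" where
  "growth_equiv f g \<longleftrightarrow> preceq f g \<and> preceq g f"

definition eta :: real where
  "eta = (THE t::real. t ^ 3 + t ^ 2 + t - 2 = 0)"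

definition alpha :: real where
  "alpha = ln 2 / ln (2 / eta)"

end

theory Submission
  imports Defs
begin

text \<open>
  The lamp configuration reached by a word over the generators of \<open>A \<wr>\<^sub>X \<Gamma>\<close> is supported on the
  inverted orbit of the underlying word \<open>w\<close> over \<open>a, b, c, d\<close>, so growth is governed by how large
  inverted orbits can be. With Bartholdi's weights, the two state words of \<open>w\<close> have total norm at
  most \<open>\<eta>\<close> times that of \<open>w\<close> (up to a favourable constant), and since \<open>2 (\<eta> / 2)\<^sup>\<alpha> = 1\<close>, concavity of
  \<open>x\<^sup>\<alpha>\<close> shows that the recursion stops after at most \<open>C n\<^sup>\<alpha>\<close> leaves. This bounds at once the size of the
  inverted orbit and the number of pairs (group element, superset of the inverted orbit). Conversely,
  the substitution \<open>ab \<mapsto> abadac\<close>, \<open>ac \<mapsto> abab\<close>, \<open>ad \<mapsto> acac\<close> multiplies lengths by \<open>2 / \<eta>\<close> and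
  essentially doubles inverted orbits. Distributing a total length \<open>n\<close> over about \<open>n\<^sup>\<alpha>\<close> lamps turns
  \<open>v\<^sub>A(n) = exp (log n \<cdot> n\<^sup>\<beta>)\<close> into \<open>exp (log n \<cdot> n\<^bsup>\<alpha> + (1 - \<alpha>) \<beta>\<^esup>)\<close>.
\<close>

section \<open>Words in the generators and their states\<close>

text \<open>An upper bound has to count inverted orbits jointly with group elements: counting words
  of length n would cost exp (c n), which exceeds every target because the exponents stay below 1.
  For this reason a single recursion, the portrait, records the group element and a superset of the
  orbit together. Its cost, of the shape exp (C log n \<cdot> n^\<alpha>), does no harm, since lamps
  with values in the integers already produce a factor of this size. The upper bound for inverted
  orbits enters the lower bound as well. Every point of the orbit is charged the same number of lamp
  letters, so a word with a large orbit helps only if its orbit is not larger than predicted. Words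
  are evaluated as composed functions, so the leftmost letter acts last. Prefixes then give the
  points of the inverted orbit, and state words are indexed by the first letter of the image instead
  of the argument. Both recursions run from the left, in step with balls, whose elements grow on the
  left.\<close>

definition scons :: "bool \<Rightarrow> seq \<Rightarrow> seq" where
  "scons y t n = (case n of 0 \<Rightarrow> y | Suc m \<Rightarrow> t m)"

lemma scons_0 [simp]: "scons y t 0 = y"
  by (simp add: scons_def)

lemma scons_Suc [simp]: "scons y t (Suc n) = t n"
  by (simp add: scons_def)

lemma seq_eqI: "u 0 = v 0 \<Longrightarrow> (\<And>n. u (Suc n) = v (Suc n)) \<Longrightarrow> u = (v :: seq)"
  by (rule ext, case_tac x) auto

lemma scons_surj: "\<exists>y t. u = scons y t"
  by (rule exI[of _ "u 0"], rule exI[of _ "\<lambda>n. u (Suc n)"]) (auto intro: seq_eqI)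

lemma scons_inject [simp]: "scons y t = scons y' t' \<longleftrightarrow> y = y' \<and> t = t'"
proof
  assume h: "scons y t = scons y' t'"
  have "t n = t' n" for n using fun_cong[OF h, of "Suc n"] by simp
  with fun_cong[OF h, of 0] show "y = y' \<and> t = t'" by auto
qed auto

lemma scons_eq_rho [simp]: "scons y t = rho \<longleftrightarrow> y \<and> t = rho"
proof -
  have "rho = scons True rho" by (intro seq_eqI) (auto simp: rho_def)
  thus ?thesis by (metis scons_inject)
qed

lemma gen_act_GA [simp]: "gen_act GA (scons y t) = scons (\<not> y) t"
  by (rule seq_eqI) (auto simp: gen_act_def)

lemma gen_act_False [simp]:
  assumes "s \<noteq> GA"
  shows "gen_act s (scons False t) = scons False (if s = GD then t else gen_act GA t)"
proof -
  have "(LEAST j. \<not> scons False t j) = 0" by (rule Least_equality) auto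
  moreover have "\<not> (\<forall>j. scons False t j)" by (auto intro!: exI[of _ 0])
  ultimately show ?thesis using assms
    by (intro seq_eqI) (auto simp: gen_act_def)
qed

lemma nxt_GA_iff [simp]: "nxt s = GA \<longleftrightarrow> s = GA"
  by (cases s) auto

text \<open>Recovers the recursive rule from the closed form: a 1 put in front moves the first 0 by
  one position and advances the state cycle once.\<close>

lemma gen_act_True [simp]:
  assumes "s \<noteq> GA"
  shows "gen_act s (scons True t) = scons True (gen_act (nxt s) t)"
proof (cases "\<forall>j. t j")
  case True
  hence "scons True t n" for n by (cases n) auto
  thus ?thesis using assms True by (simp add: gen_act_def)
next
  case False
  then obtain j where j: "\<not> t j" by auto
  have L: "(LEAST j. \<not> scons True t j) = Suc (LEAST j. \<not> t j)"
    using Least_Suc[of "\<lambda>j. \<not> scons True t j" "Suc j"] j by simp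
  have n: "\<not> (\<forall>i. scons True t i)" using j by (auto intro!: exI[of _ "Suc j"])
  have "(nxt ^^ Suc m) s = (nxt ^^ m) (nxt s)" for m
    by (simp only: funpow_Suc_right o_apply)
  thus ?thesis using assms False n
    by (intro seq_eqI) (auto simp: gen_act_def L Let_def simp del: funpow.simps)
qed

lemma gen_act_rho [simp]: "s \<noteq> GA \<Longrightarrow> gen_act s rho = rho"
  by (simp add: gen_act_def rho_def)

text \<open>The recursion defining b, c, d ends at the first 0. The sequence of ones has none, so it
  needs a case of its own.\<close>

lemma seq_zero_induct:
  assumes "\<And>t. P (scons False t)" "\<And>t. P t \<Longrightarrow> P (scons True t)" "P rho"
  shows "P (u :: seq)"
proof (cases "\<forall>j. u j")
  case True
  hence "u = rho" by (auto simp: rho_def)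
  thus ?thesis using assms(3) by simp
next
  case False
  then obtain j where "\<not> u j" by auto
  thus ?thesis
  proof (induction j arbitrary: u)
    case 0
    obtain y t where "u = scons y t" using scons_surj by blast
    thus ?case using 0 assms(1) by auto
  next
    case (Suc j)
    obtain y t where u: "u = scons y t" using scons_surj by blast
    have "P t" by (rule Suc.IH) (use Suc.prems u in auto)
    thus ?case using assms u by (cases y) auto
  qed
qed

lemma gen_act_GA_GA: "gen_act GA (gen_act GA u) = u"
  using scons_surj[of u] by auto

lemma gen_act_self [simp]: "gen_act s (gen_act s u) = u"
proof (cases "s = GA")
  case False
  have "\<forall>s. s \<noteq> GA \<longrightarrow> gen_act s (gen_act s u) = u"
    by (rule seq_zero_induct[where u = u]) (auto simp: gen_act_GA_GA)
  thus ?thesis using False by blast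
qed (simp add: gen_act_GA_GA)

section \<open>The relations of the Klein four-group\<close>

fun third :: "gen \<Rightarrow> gen \<Rightarrow> gen" where
  "third GB GC = GD" | "third GC GB = GD" | "third GB GD = GC"
| "third GD GB = GC" | "third GC GD = GB" | "third GD GC = GB"
| "third _ _ = GA"

lemma third_GA_iff: "s \<noteq> GA \<Longrightarrow> t \<noteq> GA \<Longrightarrow> third s t = GA \<longleftrightarrow> s = t"
  by (cases s; cases t) auto

lemma nxt_third: "s \<noteq> GA \<Longrightarrow> t \<noteq> GA \<Longrightarrow> s \<noteq> t \<Longrightarrow> nxt (third s t) = third (nxt s) (nxt t)"
  by (cases s; cases t) auto

lemma nxt_inject [simp]: "nxt s = nxt t \<longleftrightarrow> s = t"
  by (cases s; cases t) auto

text \<open>Along the prefix of ones both sides advance their states, and \<open>nxt\<close>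
  respects \<open>third\<close>. At the first 0 exactly two of b, c, d apply the involution a to the
  tail, so the tails agree for each pair.\<close>

lemma gen_act_third:
  assumes "s \<noteq> GA" "t \<noteq> GA" "s \<noteq> t"
  shows "gen_act s (gen_act t u) = gen_act (third s t) u"
proof -
  have "\<forall>s t. s \<noteq> GA \<longrightarrow> t \<noteq> GA \<longrightarrow> s \<noteq> t \<longrightarrow>
      gen_act s (gen_act t u) = gen_act (third s t) u"
  proof (rule seq_zero_induct[where u = u])
    show "\<forall>s t. s \<noteq> GA \<longrightarrow> t \<noteq> GA \<longrightarrow> s \<noteq> t \<longrightarrow>
      gen_act s (gen_act t (scons False v)) = gen_act (third s t) (scons False v)" for v
    proof (intro allI impI)
      fix s t :: gen
      assume "s \<noteq> GA" "t \<noteq> GA" "s \<noteq> t"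
      thus "gen_act s (gen_act t (scons False v)) = gen_act (third s t) (scons False v)"
        by (cases s; cases t) auto
    qed
  qed (auto simp: third_GA_iff nxt_third)
  thus ?thesis using assms by blast
qed

lemma bij_gen_act: "bij (gen_act s)"
  by (rule o_bij[of "gen_act s"]) auto

section \<open>Evaluation of words, inverted orbits and state words\<close>

definition ev :: "gen list \<Rightarrow> seq \<Rightarrow> seq" where
  "ev w = foldr (\<lambda>s g. gen_act s \<circ> g) w id"

lemma ev_Nil [simp]: "ev [] = id" by (simp add: ev_def)
lemma ev_Cons [simp]: "ev (s # w) = gen_act s \<circ> ev w" by (simp add: ev_def)
lemma ev_append: "ev (v @ w) = ev v \<circ> ev w" by (induction v) auto

lemma bij_ev: "bij (ev w)"
proof (induction w)
  case Nil
  show ?case by (simp only: ev_Nil bij_id)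
next
  case (Cons s w)
  show ?case unfolding ev_Cons by (rule bij_comp[OF Cons bij_gen_act])
qed

lemma ev_rev_ev: "ev (rev w) (ev w u) = u"
  by (induction w arbitrary: u) (auto simp: ev_append)

lemma ev_ev_rev: "ev w (ev (rev w) u) = u"
  using ev_rev_ev[of "rev w"] by simp

lemma inv_ev: "inv_into UNIV (ev w) = ev (rev w)"
  by (rule inv_unique_comp) (auto simp: ev_rev_ev ev_ev_rev)

lemma Grig_eq: "Grig = range ev"
proof
  show "Grig \<subseteq> range ev"
  proof
    fix g assume "g \<in> Grig"
    thus "g \<in> range ev"
    proof induction
      case Grig_id
      show ?case by (rule range_eqI[of _ _ "[]"]) simp
    next
      case (Grig_gen s)
      show ?case by (rule range_eqI[of _ _ "[s]"]) simp
    next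
      case (Grig_mult g h)
      then obtain v w where "g = ev v" "h = ev w" by auto
      hence "h \<circ> g = ev (w @ v)" by (simp only: ev_append)
      thus ?case by simp
    next
      case (Grig_inv g)
      thus ?case using inv_ev by auto
    qed
  qed
  have "ev w \<in> Grig" for w
  proof (induction w)
    case Nil
    show ?case by (simp only: ev_Nil Grig_id)
  next
    case (Cons s w)
    show ?case unfolding ev_Cons by (rule Grig_mult[OF Cons Grig_gen])
  qed
  thus "range ev \<subseteq> Grig" by auto
qed

text \<open>The points \<open>ev v rho\<close> for the prefixes \<open>v\<close> of
  \<open>w\<close>. A lamp letter read after the moves \<open>v\<close> lands at the point that
  these moves carry to \<open>rho\<close>; as the letters are involutions, this point is
  \<open>ev v rho\<close>.\<close>

primrec orb :: "gen list \<Rightarrow> seq set" where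
  "orb [] = {rho}"
| "orb (s # w) = insert rho (gen_act s ` orb w)"

lemma rho_in_orb [simp]: "rho \<in> orb w" by (cases w) auto
lemma finite_orb [simp]: "finite (orb w)" by (induction w) auto
lemma orb_Cons_V: "s \<noteq> GA \<Longrightarrow> orb (s # w) = gen_act s ` orb w"
  using gen_act_rho[of s] rho_in_orb[of w] by (metis image_eqI insert_absorb orb.simps(2))

lemma orb_append: "orb (v @ w) = orb v \<union> ev v ` orb w"
proof (induction v)
  case Nil
  have "rho \<in> orb w" by simp
  thus ?case by auto
next
  case (Cons s v)
  thus ?case by (auto simp: image_Un image_comp)
qed

text \<open>The state word of \<open>w\<close> at points whose image begins with \<open>y\<close>:
  the leftmost letter acts last, so scanning from the left runs backwards from the image.\<close>

primrec tr :: "bool \<Rightarrow> gen list \<Rightarrow> gen list" where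
  "tr y [] = []"
| "tr y (s # w) =
     (if s = GA then tr (\<not> y) w
      else if y then nxt s # tr y w
      else if s = GD then tr y w else GA # tr y w)"

lemma length_tr: "length (tr y w) \<le> length w"
proof (induction w arbitrary: y)
  case (Cons s w)
  show ?case using Cons[of y] Cons[of "\<not> y"] by auto
qed simp

primrec par :: "gen list \<Rightarrow> bool" where
  "par [] = False"
| "par (s # w) = (if s = GA then \<not> par w else par w)"

lemma ev_scons: "ev w (scons y t) = scons (y \<noteq> par w) (ev (tr (y \<noteq> par w) w) t)"
  by (induction w) auto

text \<open>Distributes an inverted orbit over the inverted orbits of the two state words. The tail
  \<open>rho\<close> lies in every inverted orbit, so only points moved by the first letter require
  the recursion.\<close>

lemma orb_tail: "scons y t \<in> orb w \<Longrightarrow> t \<in> orb (tr y w)"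
proof (induction w arbitrary: y t)
  case Nil
  thus ?case by simp
next
  case (Cons s w)
  show ?case
  proof (cases "t = rho")
    case False
    then obtain u where u: "u \<in> orb w" "scons y t = gen_act s u" using Cons.prems by auto
    obtain y' t' where u': "u = scons y' t'" using scons_surj by blast
    have t': "t' \<in> orb (tr y' w)" using Cons.IH u u' by blast
    show ?thesis
    proof (cases "s = GA")
      case True
      thus ?thesis using u u' t' by auto
    next
      case s: False
      have "y' = y" using u(2) s u' by (cases y') auto
      thus ?thesis using u u' t' s by (cases y) auto
    qed
  qed simp
qed

section \<open>Norms, portraits and the upper bound for inverted orbits\<close>

lemma strict_mono_eta_poly:
  fixes x t :: real
  assumes "x < t"
  shows "x ^ 3 + x ^ 2 + x - 2 < t ^ 3 + t ^ 2 + t - 2"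
proof -
  \<comment> \<open>The cofactor x^2 + x t + t^2 + x + t + 1 is written by completing squares, which
    shows that it is positive.\<close>
  have "t ^ 3 + t ^ 2 + t - 2 - (x ^ 3 + x ^ 2 + x - 2) =
      (t - x) * ((x + t / 2 + 1 / 2) ^ 2 + (3 * (t + 1 / 3) ^ 2 / 4 + 2 / 3))"
    by (simp add: field_simps power2_eq_square power3_eq_cube)
  moreover have "0 < (t - x) * ((x + t / 2 + 1 / 2) ^ 2 + (3 * (t + 1 / 3) ^ 2 / 4 + 2 / 3))"
    using assms by (intro mult_pos_pos add_nonneg_pos zero_le_power2) auto
  ultimately show ?thesis by linarith
qed

lemma eta_root: "eta ^ 3 + eta ^ 2 + eta - 2 = 0" and eta_pos: "0 < eta" and eta_lt_1: "eta < 1"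
proof -
  let ?f = "\<lambda>t::real. t ^ 3 + t ^ 2 + t - 2"
  have "\<exists>t\<ge>0. t \<le> 1 \<and> ?f t = 0"
    by (rule IVT) auto
  then obtain t where t: "?f t = 0" by blast
  have "eta = t" unfolding eta_def
  proof (rule the_equality)
    show "?f t = 0" by (rule t)
    fix x assume "?f x = 0"
    thus "x = t" using t strict_mono_eta_poly[of x t] strict_mono_eta_poly[of t x]
      by (cases x t rule: linorder_cases) linarith+
  qed
  thus r: "?f eta = 0" using t by (simp only:)
  show "0 < eta"
  proof (rule ccontr)
    assume "\<not> 0 < eta"
    hence "eta = 0 \<or> ?f eta < ?f 0" using strict_mono_eta_poly[of eta 0] by linarith
    thus False
    proof
      assume "eta = 0"
      thus False using r by (simp only:) simp
    qed (use r in simp)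
  qed
  show "eta < 1"
  proof (rule ccontr)
    assume "\<not> eta < 1"
    hence "eta = 1 \<or> ?f 1 < ?f eta" using strict_mono_eta_poly[of 1 eta] by linarith
    thus False
    proof
      assume "eta = 1"
      thus False using r by (simp only:) simp
    qed (use r in simp)
  qed
qed

lemma alpha_bounds: "0 < alpha" "alpha < 1"
proof -
  have "ln 2 < ln (2 / eta)" using eta_pos eta_lt_1 by (simp add: field_simps)
  moreover have "0 < ln (2::real)" by simp
  ultimately have "0 < ln (2 / eta)" "ln 2 < ln (2 / eta)" by linarith+
  thus "0 < alpha" "alpha < 1" unfolding alpha_def by auto
qed

lemma two_div_eta_powr_alpha: "(2 / eta) powr alpha = 2"
proof -
  have "ln (2 / eta) > 0" using eta_pos eta_lt_1 by (simp add: field_simps)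
  thus ?thesis using eta_pos by (simp add: powr_def alpha_def)
qed

text \<open>Bartholdi's weights; they satisfy
  \<open>\<eta>(a + b) = a + c\<close>, \<open>\<eta>(a + c) = a + d\<close>, \<open>\<eta>(a + d) = b\<close>, and \<open>b = c + d\<close>.\<close>

fun nu :: "gen \<Rightarrow> real" where
  "nu GA = 1 - eta ^ 3" | "nu GB = eta ^ 3" | "nu GC = 1 - eta ^ 2" | "nu GD = 1 - eta"

lemma nu_pos: "0 < nu s"
  using eta_pos eta_lt_1 by (cases s) (auto simp: power_less_one_iff)

lemma nu_le_1: "nu s \<le> 1"
  using eta_pos eta_lt_1 by (cases s) (auto simp: power_le_one)

lemma nu_third: "s \<noteq> GA \<Longrightarrow> t \<noteq> GA \<Longrightarrow> s \<noteq> t \<Longrightarrow> nu (third s t) \<le> nu s + nu t"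
  using eta_root nu_pos[of GC] nu_pos[of GD] by (cases s; cases t) auto

text \<open>The two tracks always read opposite letters, so a letter s among b, c, d leaves
  \<open>nxt s\<close> on one of them and a or nothing on the other. The total is exactly \<eta>
  times the norm of the pair a s.\<close>

lemma nu_nxt:
  "s \<noteq> GA \<Longrightarrow> nu (nxt s) + (if s = GD then 0 else nu GA) = eta * (nu GA + nu s)"
proof (cases s)
  case GC
  have "eta * (nu GA + nu GC) - (nu GD + nu GA) = (1 - eta) * (eta ^ 3 + eta ^ 2 + eta - 2)"
    by (simp add: algebra_simps power2_eq_square power3_eq_cube)
  thus ?thesis using GC eta_root by simp
next
  case GD
  have "eta * (nu GA + nu GD) - nu GB = - eta * (eta ^ 3 + eta ^ 2 + eta - 2)"
    by (simp add: algebra_simps power2_eq_square power3_eq_cube)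
  thus ?thesis using GD eta_root by simp
next
  case GB
  thus ?thesis using eta_root by (simp add: algebra_simps power2_eq_square power3_eq_cube)
qed simp

definition nrm :: "gen list \<Rightarrow> real" where
  "nrm w = sum_list (map nu w)"

lemma nrm_Nil [simp]: "nrm [] = 0" by (simp add: nrm_def)
lemma nrm_Cons [simp]: "nrm (s # w) = nu s + nrm w" by (simp add: nrm_def)
lemma nrm_nonneg: "0 \<le> nrm w" by (induction w) (auto intro: add_nonneg_nonneg less_imp_le[OF nu_pos])
lemma nrm_le_length: "nrm w \<le> length w"
  by (induction w) (auto intro: add_mono nu_le_1)

text \<open>Every letter among b, c, d is charged together with an a, present or not. In this form
  the norm of both state words is an exact multiple of the sum, and alternation enters only in the
  comparison with \<open>nrm\<close>.\<close>

primrec vsum :: "gen list \<Rightarrow> real" where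
  "vsum [] = 0"
| "vsum (s # w) = (if s = GA then vsum w else nu GA + nu s + vsum w)"

lemma nrm_tr_aux: "nrm (tr True w) + nrm (tr False w) = eta * vsum w"
proof (induction w)
  case (Cons s w)
  show ?case using Cons nu_nxt[of s]
    by (cases "s = GA") (auto simp: algebra_simps split: if_splits)
qed simp

lemma nrm_tr: "nrm (tr y w) + nrm (tr (\<not> y) w) = eta * vsum w"
  using nrm_tr_aux[of w] by (cases y) auto

primrec alt :: "gen list \<Rightarrow> bool" where
  "alt [] = True"
| "alt (s # w) = (alt w \<and> (s \<noteq> GA \<longrightarrow> (\<exists>w'. w = GA # w')))"

text \<open>In an alternating word each letter among b, c, d is followed by an a of its own, which
  pays for the charge. The induction keeps a leading a in reserve, as a letter put in front may
  still claim it.\<close>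

lemma vsum_le_nrm: "alt w \<Longrightarrow> vsum w \<le> nrm w"
proof -
  have "alt w \<Longrightarrow> vsum w \<le> nrm w - (if \<exists>w'. w = GA # w' then nu GA else 0)"
  proof (induction w)
    case (Cons s w)
    have "vsum w \<le> nrm w - (if \<exists>w'. w = GA # w' then nu GA else 0)"
      using Cons by simp
    thus ?case using Cons.prems nu_pos[of GA] by (auto split: if_splits)
  qed simp
  thus "alt w \<Longrightarrow> vsum w \<le> nrm w" using nu_pos[of GA] by (auto split: if_splits)
qed

text \<open>Merging adjacent letters of the Klein four-group \<open>{1,b,c,d}\<close> and dropping trailing ones
  does not change inverted orbits, since these letters fix \<open>rho\<close>.
  Subwords \<open>aa\<close> must not be cancelled: that would lose points.\<close>

fun rcons :: "gen \<Rightarrow> gen list \<Rightarrow> gen list" where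
  "rcons s [] = (if s = GA then [GA] else [])"
| "rcons s (t # w) =
     (if s = GA \<or> t = GA then s # t # w else if s = t then w else third s t # w)"

definition red :: "gen list \<Rightarrow> gen list" where
  "red w = foldr rcons w []"

lemma red_Nil [simp]: "red [] = []" by (simp add: red_def)
lemma red_Cons [simp]: "red (s # w) = rcons s (red w)" by (simp add: red_def)

lemma alt_rcons: "alt w \<Longrightarrow> alt (rcons s w)"
  by (cases w) (auto simp: third_GA_iff)

lemma alt_red: "alt (red w)"
  by (induction w) (auto intro: alt_rcons)

lemma length_red: "length (red w) \<le> length w"
proof -
  have "length (rcons s w) \<le> Suc (length w)" for s w
    by (cases w) auto
  thus ?thesis by (induction w) (auto intro: order_trans)
qed

lemma nrm_red: "nrm (red w) \<le> nrm w"
proof -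
  have "nrm (rcons s w) \<le> nu s + nrm w" for s w
    using nu_pos[of s] nu_pos[of "hd w"] nu_third[of s "hd w"] by (cases w) auto
  note r = this
  show ?thesis
  proof (induction w)
    case (Cons s w)
    thus ?case using r[of s "red w"] by simp
  qed simp
qed

lemma image_gen_act_self [simp]: "gen_act s ` gen_act s ` Y = Y"
  by (simp add: image_image)

lemma orb_red: "orb (red w) = orb w"
proof -
  have r: "orb (rcons s w) = orb (s # w)" if "alt w" for s w
  proof (cases w)
    case (Cons t w')
    show ?thesis
    proof (cases "s = GA \<or> t = GA")
      case False
      hence "orb (s # t # w') = gen_act s ` gen_act t ` orb w'"
        by (simp add: orb_Cons_V del: orb.simps)
      also have "\<dots> = orb (rcons s (t # w'))"
      proof (cases "s = t")
        case False
        thus ?thesis using \<open>\<not> (s = GA \<or> t = GA)\<close>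
          by (auto simp: orb_Cons_V third_GA_iff image_image gen_act_third simp del: orb.simps)
      qed (use False in auto)
      finally show ?thesis using Cons by simp
    qed (use Cons in auto)
  qed auto
  show ?thesis
  proof (induction w)
    case (Cons s w)
    thus ?case using r[OF alt_red[of w], of s] by simp
  qed simp
qed

section \<open>Portraits of group elements and their number\<close>

definition V4 :: "(seq \<Rightarrow> seq) set" where
  "V4 = insert id (gen_act ` {GB, GC, GD})"

lemma gen_act_in_V4: "s \<noteq> GA \<Longrightarrow> gen_act s \<in> V4"
  by (cases s) (auto simp: V4_def)

lemma finite_V4: "finite V4" and card_V4: "card V4 \<le> 4"
proof -
  have "V4 = set [id, gen_act GB, gen_act GC, gen_act GD]" by (auto simp: V4_def)
  thus "card V4 \<le> 4" using card_length[of "[id, gen_act GB, gen_act GC, gen_act GD]"]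
    by simp
  show "finite V4" by (simp add: V4_def)
qed

lemma gen_act_comp_V4:
  assumes "s \<noteq> GA" "v \<in> V4"
  shows "gen_act s \<circ> v \<in> V4"
proof (cases "v = id")
  case True
  thus ?thesis using assms gen_act_in_V4 by simp
next
  case False
  then obtain t where t: "t \<noteq> GA" "v = gen_act t" using assms by (auto simp: V4_def)
  show ?thesis
  proof (cases "s = t")
    case True
    hence "gen_act s \<circ> v = id" using t by (intro ext) simp
    thus ?thesis by (simp add: V4_def)
  next
    case False
    hence "gen_act s \<circ> v = gen_act (third s t)" using t assms
      by (intro ext) (simp add: gen_act_third)
    thus ?thesis using False t assms by (auto simp: third_GA_iff intro: gen_act_in_V4)
  qed
qed

lemma ev_red: "\<exists>v\<in>V4. ev w = ev (red w) \<circ> v"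
proof (induction w)
  case Nil
  have "id \<in> V4" by (simp add: V4_def)
  thus ?case by (intro bexI[of _ id]) (simp_all only: red_Nil ev_Nil comp_id)
next
  case (Cons s w)
  then obtain v where v: "v \<in> V4" "ev w = ev (red w) \<circ> v" by blast
  show ?case
  proof (cases "red w = [] \<and> s \<noteq> GA")
    case True
    hence "gen_act s \<circ> v \<in> V4" "ev (s # w) = ev (red (s # w)) \<circ> (gen_act s \<circ> v)"
      using v gen_act_comp_V4 by auto
    thus ?thesis by blast
  next
    case False
    have "gen_act s (ev (red w) u) = ev (rcons s (red w)) u" for u
      using False by (cases "red w") (auto simp: gen_act_third)
    hence "ev (s # w) = ev (red (s # w)) \<circ> v"
      using v(2) by (intro ext) simp
    thus ?thesis using v by blast
  qed
qed

text \<open>A tree automorphism with states \<open>g\<close>, \<open>h\<close> and root permutation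
  given by \<open>e\<close>, between two decorations from \<open>V4\<close>: \<open>s\<close> is a
  leading letter split off, \<open>v\<close> collects the trailing letters dropped by reduction. As
  in \<open>tr\<close>, states are indexed by the first letter of the image.\<close>

definition node_fun ::
    "bool \<Rightarrow> (seq \<Rightarrow> seq) \<Rightarrow> (seq \<Rightarrow> seq) \<Rightarrow> (seq \<Rightarrow> seq) \<Rightarrow> (seq \<Rightarrow> seq) \<Rightarrow> seq \<Rightarrow> seq" where
  "node_fun e s v g h = s \<circ> (\<lambda>u. scons (u 0 \<noteq> e) ((if u 0 \<noteq> e then h else g) (u \<circ> Suc))) \<circ> v"

definition node_set :: "(seq \<Rightarrow> seq) \<Rightarrow> seq set \<Rightarrow> seq set \<Rightarrow> seq set" where
  "node_set s Y Z = s ` (scons False ` Y \<union> scons True ` Z)"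

text \<open>\<open>port n g Y\<close>: \<open>g\<close> has a portrait with at most \<open>n\<close> leaves, and \<open>Y\<close> is the set of points
  obtained from the point \<open>rho\<close> below each of these leaves.\<close>

inductive port :: "nat \<Rightarrow> (seq \<Rightarrow> seq) \<Rightarrow> seq set \<Rightarrow> bool" where
  port_leaf: "v \<in> V4 \<Longrightarrow> 1 \<le> n \<Longrightarrow> port n v {rho}"
| port_node: "port i g Y \<Longrightarrow> port j h Z \<Longrightarrow> i + j \<le> n \<Longrightarrow> s \<in> V4 \<Longrightarrow> v \<in> V4 \<Longrightarrow>
    port n (node_fun e s v g h) (node_set s Y Z)"

lemma port_mono: "port m g Y \<Longrightarrow> m \<le> n \<Longrightarrow> port n g Y"
  by (induction rule: port.induct) (auto intro: port.intros)

lemma port_pos: "port n g Y \<Longrightarrow> 1 \<le> n"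
  by (induction rule: port.induct) auto

lemma port_finite: "port n g Y \<Longrightarrow> finite Y \<and> card Y \<le> n"
proof (induction rule: port.induct)
  case (port_node i g Y j h Z n s v e)
  have "card (node_set s Y Z) \<le> card (scons False ` Y \<union> scons True ` Z)"
    unfolding node_set_def using port_node by (intro card_image_le) auto
  also have "\<dots> \<le> card (scons False ` Y) + card (scons True ` Z)" by (rule card_Un_le)
  also have "\<dots> \<le> card Y + card Z" using port_node by (intro add_mono card_image_le) auto
  finally show ?case using port_node by (auto simp: node_set_def)
qed auto

definition ports :: "nat \<Rightarrow> ((seq \<Rightarrow> seq) \<times> seq set) set" where
  "ports n = {(g, Y). port n g Y}"

text \<open>Monotonicity in the number of leaves lets the second subtree use the whole remainder
  \<open>n - i\<close>, so one index \<open>i\<close> describes the split. Positivity of leaf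
  numbers keeps \<open>i\<close> strictly between 0 and n.\<close>

lemma ports_subset:
  "ports n \<subseteq> (\<lambda>v. (v, {rho})) ` V4 \<union>
     (\<Union>i\<in>{1..<n}. (\<lambda>((e, s, v), (g, Y), (h, Z)). (node_fun e s v g h, node_set s Y Z)) `
        ((UNIV \<times> V4 \<times> V4) \<times> ports i \<times> ports (n - i)))"
proof
  fix p assume "p \<in> ports n"
  then obtain g Y where p: "p = (g, Y)" "port n g Y" by (auto simp: ports_def)
  from p(2) show "p \<in> (\<lambda>v. (v, {rho})) ` V4 \<union>
     (\<Union>i\<in>{1..<n}. (\<lambda>((e, s, v), (g, Y), (h, Z)). (node_fun e s v g h, node_set s Y Z)) `
        ((UNIV \<times> V4 \<times> V4) \<times> ports i \<times> ports (n - i)))"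
  proof cases
    case port_leaf
    thus ?thesis using p by auto
  next
    case (port_node i g' Y' j h Z s v e)
    have "1 \<le> i" "1 \<le> j" using port_node port_pos by auto
    hence i: "i \<in> {1..<n}" using port_node by auto
    have m: "((e, s, v), (g', Y'), (h, Z)) \<in> (UNIV \<times> V4 \<times> V4) \<times> ports i \<times> ports (n - i)"
      using port_node port_mono[of j h Z "n - i"] by (auto simp: ports_def)
    show ?thesis
      by (rule UnI2, rule UN_I[OF i], rule image_eqI[OF _ m]) (simp add: p port_node)
  qed
qed

text \<open>The exponents 2 i - 1 and 2 (n - i) - 1 of a split add up to 2 n - 2. The factor 32 n
  that is left pays for the 2 \<cdot> 4 \<cdot> 4 decorations of a node at each of n - 1 splits, and
  for the portraits that are a single leaf.\<close>

lemma ports_card: "finite (ports n) \<and> (1 \<le> n \<longrightarrow> card (ports n) \<le> (32 * n) ^ (2 * n - 1))"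
proof (induction n rule: less_induct)
  case (less n)
  define F where "F = (\<lambda>i. (\<lambda>((e::bool, s, v), (g, Y), (h, Z)).
      (node_fun e s v g h, node_set s Y Z)) `
        ((UNIV \<times> V4 \<times> V4) \<times> ports i \<times> ports (n - i)))"
  have fin: "finite (F i)" if "i \<in> {1..<n}" for i
    using less.IH[of i] less.IH[of "n - i"] that finite_V4 unfolding F_def
    by (intro finite_imageI finite_cartesian_product) auto
  have sub: "ports n \<subseteq> (\<lambda>v. (v, {rho})) ` V4 \<union> (\<Union>i\<in>{1..<n}. F i)"
    using ports_subset[of n] by (simp add: F_def)
  have fin': "finite ((\<lambda>v. (v, {rho})) ` V4 \<union> (\<Union>i\<in>{1..<n}. F i))"
    using fin finite_V4 by auto
  have cF: "card (F i) \<le> 32 * (32 * n) ^ (2 * n - 2)" if i: "i \<in> {1..<n}" for i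
  proof -
    have "card (F i) \<le> card (((UNIV::bool set) \<times> V4 \<times> V4) \<times> ports i \<times> ports (n - i))"
      using less.IH[of i] less.IH[of "n - i"] that finite_V4 unfolding F_def
      by (intro card_image_le finite_cartesian_product) auto
    also have "\<dots> = 2 * (card V4 * card V4) * (card (ports i) * card (ports (n - i)))"
      by (simp add: card_cartesian_product)
    also have "\<dots> \<le> 2 * (4 * 4) * ((32 * i) ^ (2 * i - 1) * (32 * (n - i)) ^ (2 * (n - i) - 1))"
      using less.IH[of i] less.IH[of "n - i"] that card_V4 by (intro mult_mono) auto
    also have "\<dots> \<le> 2 * (4 * 4) * ((32 * n) ^ (2 * i - 1) * (32 * n) ^ (2 * (n - i) - 1))"
      using i by (intro mult_mono power_mono) auto
    also have "\<dots> = 32 * (32 * n) ^ (2 * i - 1 + (2 * (n - i) - 1))"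
      by (simp add: power_add)
    also have "2 * i - 1 + (2 * (n - i) - 1) = 2 * n - 2" using i by auto
    finally show ?thesis .
  qed
  have "card (ports n) \<le> (32 * n) ^ (2 * n - 1)" if n: "1 \<le> n"
  proof -
    have "card (ports n) \<le> card ((\<lambda>v. (v, {rho})) ` V4 \<union> (\<Union>i\<in>{1..<n}. F i))"
      by (rule card_mono[OF fin' sub])
    also have "\<dots> \<le> card ((\<lambda>v. (v, {rho})) ` V4) + card (\<Union>i\<in>{1..<n}. F i)"
      by (rule card_Un_le)
    also have "\<dots> \<le> 4 + (\<Sum>i\<in>{1..<n}. card (F i))"
      using card_image_le[OF finite_V4, of "\<lambda>v. (v, {rho})"] card_V4
      by (intro add_mono card_UN_le) auto
    also have "\<dots> \<le> 4 + (\<Sum>i\<in>{1..<n}. 32 * (32 * n) ^ (2 * n - 2))"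
      using cF by (intro add_mono sum_mono) auto
    also have "\<dots> = 4 + (n - 1) * (32 * (32 * n) ^ (2 * n - 2))" by simp
    also have "\<dots> \<le> 32 * (32 * n) ^ (2 * n - 2) + (n - 1) * (32 * (32 * n) ^ (2 * n - 2))"
    proof -
      have "(1::nat) \<le> (32 * n) ^ (2 * n - 2)" using n by (intro one_le_power) auto
      thus ?thesis by linarith
    qed
    also have "\<dots> = (32 * n) * (32 * n) ^ (2 * n - 2)"
      using n by (cases n) (auto simp: algebra_simps)
    also have "\<dots> = (32 * n) ^ (2 * n - 1)"
    proof -
      have "2 * n - 1 = Suc (2 * n - 2)" using n by simp
      thus ?thesis by simp
    qed
    finally show ?thesis .
  qed
  thus ?case using finite_subset[OF sub fin'] by blast
qed

text \<open>The shift that makes the norm recursion homogeneous: with a = \<open>nu GA\<close>, the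
  bound x0 + x1 \<le> \<eta> (x - a) becomes (x0 + B0) + (x1 + B0) \<le> \<eta> (x + B0).\<close>

definition B0 :: real where
  "B0 = nu GA / (2 / eta - 1)"

lemma B0_pos: "0 < B0"
  using eta_pos eta_lt_1 nu_pos[of GA] by (simp add: B0_def field_simps)

section \<open>Concavity of powers and the number of leaves\<close>

lemma powr_le_tangent:
  fixes t r :: real
  assumes "0 < t" "0 \<le> r" "r \<le> 1"
  shows "t powr r \<le> 1 + r * (t - 1)"
proof -
  define w where "w = 1 + r * (t - 1)"
  have w: "0 < w"
  proof (cases "r = 1")
    case False
    have "0 \<le> r * t" "0 < 1 - r" using assms False by auto
    thus ?thesis unfolding w_def by (simp add: algebra_simps)
  qed (use assms in \<open>simp add: w_def\<close>)
  \<comment> \<open>Concavity of the logarithm at t and 1 with weights r, 1 - r and mean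
    \<open>w\<close>, derived from ln y \<le> y - 1 at y = t / w and y = 1 / w.\<close>
  have "r * ln (t / w) + (1 - r) * ln (1 / w) \<le> r * (t / w - 1) + (1 - r) * (1 / w - 1)"
    using assms w ln_le_minus_one[of "t / w"] ln_le_minus_one[of "1 / w"]
    by (intro add_mono mult_left_mono) auto
  also have "\<dots> = 0" using w by (simp add: w_def field_simps)
  finally have "r * ln t \<le> ln w"
    using assms w by (simp add: ln_div algebra_simps)
  hence "exp (r * ln t) \<le> w" using w by (metis exp_le_cancel_iff exp_ln)
  thus ?thesis using assms by (simp add: powr_def w_def)
qed

text \<open>Both powers lie below the tangent at the midpoint, and the two slope terms
  cancel.\<close>

lemma concave_powr_two:
  fixes p q r :: real
  assumes "0 < p" "0 < q" "0 \<le> r" "r \<le> 1"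
  shows "p powr r + q powr r \<le> 2 * ((p + q) / 2) powr r"
proof -
  define m where "m = (p + q) / 2"
  have m: "0 < m" using assms by (simp add: m_def)
  have "p powr r + q powr r = m powr r * ((p / m) powr r + (q / m) powr r)"
    using assms m by (simp add: powr_divide distrib_left)
  also have "\<dots> \<le> m powr r * ((1 + r * (p / m - 1)) + (1 + r * (q / m - 1)))"
    using assms m by (intro mult_left_mono add_mono powr_le_tangent) auto
  also have "(1 + r * (p / m - 1)) + (1 + r * (q / m - 1)) = 2 + r * ((p + q) / m - 2)"
    using m by (simp add: algebra_simps add_divide_distrib)
  also have "p + q = 2 * m" by (simp add: m_def)
  finally have "p powr r + q powr r \<le> m powr r * (2 + r * (2 * m / m - 2))" .
  moreover have "2 * m / m = 2" using m by simp
  ultimately show ?thesis by (simp add: m_def[symmetric] mult.commute)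
qed

text \<open>The length drops because the leading a of the reduced word leaves nothing on either
  track; the same letter supplies the loss \<open>nu GA\<close> behind \<open>B0\<close>. A leaf
  costs 1, which the shifted bound allows already at norm 0. The set \<open>Y\<close> may exceed the
  orbit, but it is determined by the portrait and so is counted with it.\<close>

lemma port_exists:
  "\<exists>n Y. port n (ev w) Y \<and> orb w \<subseteq> Y \<and> real n \<le> ((nrm w + B0) / B0) powr alpha"
proof (induction "length w" arbitrary: w rule: less_induct)
  case less
  obtain v where v: "v \<in> V4" "ev w = ev (red w) \<circ> v" using ev_red by blast
  show ?case
  proof (cases "red w = []")
    case True
    have "1 \<le> ((nrm w + B0) / B0) powr alpha"
      using B0_pos nrm_nonneg[of w] alpha_bounds by (intro ge_one_powr_ge_zero) auto
    moreover have "port 1 (ev w) {rho}" using True v by (auto intro: port_leaf)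
    moreover have "orb w = {rho}" using orb_red[of w] True by simp
    ultimately show ?thesis by (intro exI[of _ 1] exI[of _ "{rho}"]) auto
  next
    case False
    \<comment> \<open>A leading letter among b, c, d joins the decoration of the node. It fixes
      \<open>rho\<close>, so splitting it off loses no point of the orbit, and the rest starts with
      a.\<close>
    have "\<exists>s c. s \<in> V4 \<and> ev (red w) = s \<circ> ev (GA # c) \<and> orb (red w) = s ` orb (GA # c)
        \<and> nrm (GA # c) \<le> nrm (red w) \<and> alt c \<and> length (GA # c) \<le> length (red w)"
    proof (cases "hd (red w) = GA")
      case True
      then obtain c where c: "red w = GA # c" using False by (cases "red w") auto
      thus ?thesis using alt_red[of w]
        by (intro exI[of _ id] exI[of _ c]) (auto simp: V4_def)
    next
      case h: False
      then obtain s c where c: "red w = s # GA # c" "s \<noteq> GA"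
        using False alt_red[of w] by (cases "red w") auto
      thus ?thesis using alt_red[of w] nu_pos[of s]
        by (intro exI[of _ "gen_act s"] exI[of _ c])
          (auto intro: gen_act_in_V4 simp: orb_Cons_V simp del: orb.simps)
    qed
    then obtain s c where c: "s \<in> V4" "ev (red w) = s \<circ> ev (GA # c)"
        "orb (red w) = s ` orb (GA # c)" "nrm (GA # c) \<le> nrm (red w)" "alt c"
        "length (GA # c) \<le> length (red w)" by blast
    let ?t = "\<lambda>y. tr y (GA # c)"
    have len: "length (?t y) < length w" for y
      using length_tr[of "\<not> y" c] c(6) length_red[of w] by auto
    obtain i Y where i: "port i (ev (?t False)) Y" "orb (?t False) \<subseteq> Y"
        "real i \<le> ((nrm (?t False) + B0) / B0) powr alpha"
      using less(1)[OF len[of False]] by blast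
    obtain j Z where j: "port j (ev (?t True)) Z" "orb (?t True) \<subseteq> Z"
        "real j \<le> ((nrm (?t True) + B0) / B0) powr alpha"
      using less(1)[OF len[of True]] by blast
    have "ev (GA # c) u =
        scons (u 0 \<noteq> par (GA # c)) ((if u 0 \<noteq> par (GA # c) then ev (?t True) else ev (?t False)) (u \<circ> Suc))" for u
    proof -
      have "u = scons (u 0) (u \<circ> Suc)" by (rule seq_eqI) auto
      thus ?thesis using ev_scons[of "GA # c" "u 0" "u \<circ> Suc"] by (auto simp del: ev_Cons)
    qed
    hence "ev (GA # c) = (\<lambda>u. scons (u 0 \<noteq> par (GA # c))
        ((if u 0 \<noteq> par (GA # c) then ev (?t True) else ev (?t False)) (u \<circ> Suc)))" by (rule ext)
    hence g: "ev w = node_fun (par (GA # c)) s v (ev (?t False)) (ev (?t True))"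
      unfolding node_fun_def by (simp only: v(2) c(2))
    have "orb (GA # c) \<subseteq> scons False ` Y \<union> scons True ` Z"
    proof
      fix x assume x: "x \<in> orb (GA # c)"
      obtain y t where y: "x = scons y t" using scons_surj by blast
      have "t \<in> orb (?t y)" using orb_tail x y by blast
      thus "x \<in> scons False ` Y \<union> scons True ` Z" using y i(2) j(2) by (cases y) auto
    qed
    hence O: "orb w \<subseteq> node_set s Y Z"
      using c(3) orb_red[of w] by (auto simp: node_set_def)
    define x0 x1 where "x0 = nrm (?t False)" and "x1 = nrm (?t True)"
    have x: "0 \<le> x0" "0 \<le> x1" by (auto simp: x0_def x1_def nrm_nonneg simp del: tr.simps)
    have "x0 + x1 = eta * vsum c" using nrm_tr[of True c] by (simp add: x0_def x1_def)
    also have "\<dots> \<le> eta * (nrm w - nu GA)"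
      using vsum_le_nrm[OF c(5)] c(4) nrm_red[of w] eta_pos by (intro mult_left_mono) auto
    finally have sum: "x0 + x1 \<le> eta * (nrm w - nu GA)" .
    have "real (i + j) \<le> ((x0 + B0) / B0) powr alpha + ((x1 + B0) / B0) powr alpha"
      using i(3) j(3) by (simp add: x0_def x1_def)
    also have "\<dots> \<le> 2 * (((x0 + B0) / B0 + (x1 + B0) / B0) / 2) powr alpha"
      using x B0_pos alpha_bounds by (intro concave_powr_two) auto
    also have "\<dots> = (2 / eta * (((x0 + B0) / B0 + (x1 + B0) / B0) / 2)) powr alpha"
      using x B0_pos eta_pos two_div_eta_powr_alpha
      by (subst powr_mult) auto
    also have "\<dots> \<le> ((nrm w + B0) / B0) powr alpha"
    proof (rule powr_mono2)
      have e: "(2 - eta) * B0 = eta * nu GA"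
        using eta_pos eta_lt_1 by (simp add: B0_def field_simps)
      have "2 / eta * (((x0 + B0) / B0 + (x1 + B0) / B0) / 2) = ((x0 + x1 + 2 * B0) / eta) / B0"
        using B0_pos eta_pos by (simp add: field_simps)
      also have "\<dots> \<le> (nrm w + B0) / B0"
      proof (rule divide_right_mono)
        show "(x0 + x1 + 2 * B0) / eta \<le> nrm w + B0"
          using sum e eta_pos by (simp add: field_simps)
      qed (use B0_pos in simp)
      finally show "2 / eta * (((x0 + B0) / B0 + (x1 + B0) / B0) / 2) \<le> (nrm w + B0) / B0" .
    qed (use x B0_pos eta_pos alpha_bounds in auto)
    finally have "real (i + j) \<le> ((nrm w + B0) / B0) powr alpha" .
    moreover have "port (i + j) (ev w) (node_set s Y Z)"
      unfolding g by (rule port_node) (use i j c v in auto)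
    ultimately show ?thesis using O by blast
  qed
qed

section \<open>Words with large inverted orbits\<close>

text \<open>An entry \<open>s\<close> stands for the syllable a s; the letters a are supplied by
  \<open>aword\<close>.\<close>

fun theta1 :: "gen \<Rightarrow> gen list" where
  "theta1 GB = [GB, GD, GC]" | "theta1 GC = [GB, GB]" | "theta1 GD = [GC, GC]" | "theta1 GA = []"

definition theta :: "gen list \<Rightarrow> gen list" where
  "theta ss = concat (map theta1 ss)"

lemma theta_Nil [simp]: "theta [] = []" by (simp add: theta_def)
lemma theta_Cons [simp]: "theta (s # ss) = theta1 s @ theta ss" by (simp add: theta_def)

lemma GA_notin_theta: "GA \<notin> set (theta ss)"
proof (induction ss)
  case (Cons s ss)
  thus ?case by (cases s) auto
qed simp

primrec aword :: "gen list \<Rightarrow> gen list" where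
  "aword [] = []"
| "aword (s # ss) = GA # s # aword ss"

lemma aword_append: "aword (ss @ M) = aword ss @ aword M"
  by (induction ss) auto

lemma length_aword: "length (aword ss) = 2 * length ss"
  by (induction ss) auto

lemma scons_rho: "scons True rho = rho" by simp

lemma rho_eq_scons [simp]: "rho = scons y t \<longleftrightarrow> y \<and> t = rho"
  using scons_eq_rho[of y t] by (simp add: eq_commute)

lemma gen_act_GA_rho: "gen_act GA rho = scons False rho"
  by (subst scons_rho[symmetric]) simp

text \<open>A converse of \<open>orb_tail\<close> for alternating words. The final a starts the
  induction: it puts both first letters, with tail \<open>rho\<close>, into the orbit.\<close>

lemma orb_split:
  assumes "GA \<notin> set ss" "t \<in> orb (tr y (aword ss @ [GA]))"
  shows "scons y t \<in> orb (aword ss @ [GA])"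
  using assms
proof (induction ss arbitrary: y t)
  case Nil
  hence "t = rho" by simp
  thus ?case by (cases y) (auto simp: gen_act_GA_rho)
next
  case (Cons s ss)
  have s: "s \<noteq> GA" using Cons.prems by auto
  let ?w = "aword ss @ [GA]"
  have a: "scons (\<not> y) t' \<in> orb (s # ?w) \<Longrightarrow> scons y t' \<in> orb (aword (s # ss) @ [GA])" for t'
    using imageI[of "scons (\<not> y) t'" "orb (s # ?w)" "gen_act GA"] by simp
  show ?case
  proof (cases y)
    case True
    show ?thesis
    proof (cases "t = rho")
      case False
      hence "\<exists>t'. t' \<in> orb (tr False ?w) \<and> t = (if s = GD then t' else gen_act GA t')"
        using Cons.prems True s False by (cases "s = GD") auto
      then obtain t' where t': "t' \<in> orb (tr False ?w)" "t = (if s = GD then t' else gen_act GA t')"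
        by blast
      have "scons False t' \<in> orb ?w" using Cons.IH[OF _ t'(1)] Cons.prems by auto
      hence "scons False t \<in> orb (s # ?w)" using t'(2) s
        imageI[of "scons False t'" "orb ?w" "gen_act s"] by (auto split: if_splits)
      thus ?thesis using a True by simp
    qed (use True in simp)
  next
    case False
    hence "t \<in> orb (nxt s # tr True ?w)" using Cons.prems s by auto
    then obtain t' where t': "t' \<in> orb (tr True ?w)" "t = gen_act (nxt s) t'"
      using orb_Cons_V[of "nxt s" "tr True ?w"] s by auto
    have "scons True t' \<in> orb ?w" using Cons.IH[OF _ t'(1)] Cons.prems by auto
    hence "scons True t \<in> orb (s # ?w)" using t'(2) s
      by (auto intro!: image_eqI[of _ "gen_act s" "scons True t'"])
    thus ?thesis using a False by simp
  qed
qed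

text \<open>The two tracks of the image of a word under the substitution both reproduce that word,
  up to conjugation by \<open>a\<close> and the length of the last syllable.\<close>

lemma orb_theta:
  assumes "GA \<notin> set ss"
  shows "orb (aword ss) \<subseteq> orb (tr True (aword (theta ss) @ [GA])) \<and>
         orb (aword ss) \<subseteq> orb (GA # tr False (aword (theta ss) @ [GA]))"
  using assms
proof (induction ss)
  case (Cons s ss)
  let ?R = "aword (theta ss) @ [GA]"
  have IH: "orb (aword ss) \<subseteq> orb (tr True ?R)" "orb (aword ss) \<subseteq> orb (GA # tr False ?R)"
    using Cons.IH Cons.prems by (simp_all del: orb.simps)
  have mono: "orb v \<subseteq> orb w \<Longrightarrow> orb (t # v) \<subseteq> orb (t # w)" for t v w
    by auto
  note mono2 = mono[OF mono]
  \<comment> \<open>On the second track the syllable a b comes back as a c d, which is the same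
    group element; all other syllables come back letter by letter.\<close>
  have b: "orb (GB # w) = orb (GC # GD # w)" for w
    by (simp add: orb_Cons_V image_image gen_act_third del: orb.simps)
  have s: "s \<noteq> GA" using Cons.prems by auto
  have "orb (GA # s # aword ss) \<subseteq> orb (tr True (aword (theta (s # ss)) @ [GA]))"
  proof (cases s)
    case GB
    show ?thesis using mono2[OF IH(2), of GA GB] GB
      by (simp add: aword_append del: orb.simps)
  next
    case GC
    show ?thesis using mono2[OF IH(1), of GA GC] GC
      by (simp add: aword_append del: orb.simps)
  next
    case GD
    show ?thesis using mono2[OF IH(1), of GA GD] GD
      by (simp add: aword_append del: orb.simps)
  qed (use s in simp)
  moreover have "orb (GA # s # aword ss) \<subseteq> orb (GA # tr False (aword (theta (s # ss)) @ [GA]))"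
  proof (cases s)
    case GB
    have "orb (GA # GB # aword ss) \<subseteq> orb (GA # GC # GD # tr True ?R)"
      using mono2[OF IH(1), of GA GB] by (simp only: orb.simps(2)[of GA] b)
    thus ?thesis using GB by (simp add: aword_append del: orb.simps)
  next
    case GC
    show ?thesis using mono2[OF IH(2), of GA GC] GC
      by (simp add: aword_append del: orb.simps)
  next
    case GD
    show ?thesis using mono2[OF IH(2), of GA GD] GD
      by (simp add: aword_append del: orb.simps)
  qed (use s in simp)
  ultimately show ?case by (simp only: aword.simps)
qed simp

lemma ev_rho_in_orb: "ev w rho \<in> orb w"
  by (induction w) auto

lemma card_orb_snoc: "card (orb (w @ [GA])) \<le> card (orb w) + 1"
proof -
  have "orb (w @ [GA]) = insert (ev w (gen_act GA rho)) (orb w)"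
    using ev_rho_in_orb[of w] by (auto simp: orb_append)
  thus ?thesis by (simp add: card_insert_if)
qed

lemma card_orb_Cons: "card (orb (s # w)) \<le> card (orb w) + 1"
  using card_image_le[OF finite_orb, of "gen_act s" w]
  by (simp add: card_insert_if)

text \<open>The tracks yield disjoint parts of the orbit, told apart by the first letter. Of the 3
  lost points, two come from the final a in the two copies of the old word and one from the
  conjugating a on the second track.\<close>

lemma card_orb_theta:
  assumes "GA \<notin> set ss"
  shows "2 * card (orb (aword ss @ [GA])) \<le> card (orb (aword (theta ss) @ [GA])) + 3"
proof -
  let ?w = "aword (theta ss) @ [GA]"
  have "(\<Union>y\<in>UNIV. scons y ` orb (tr y ?w)) \<subseteq> orb ?w"
    using orb_split[OF GA_notin_theta] by blast
  hence "card (\<Union>y\<in>UNIV. scons y ` orb (tr y ?w)) \<le> card (orb ?w)"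
    by (intro card_mono) auto
  also have "card (\<Union>y\<in>UNIV. scons y ` orb (tr y ?w)) = (\<Sum>y\<in>UNIV. card (scons y ` orb (tr y ?w)))"
    by (intro card_UN_disjoint) auto
  also have "\<dots> = (\<Sum>y\<in>UNIV. card (orb (tr y ?w)))"
    by (intro sum.cong card_image inj_onI) auto
  also have "\<dots> = card (orb (tr True ?w)) + card (orb (tr False ?w))"
    by (simp add: UNIV_bool)
  finally have 1: "card (orb (tr True ?w)) + card (orb (tr False ?w)) \<le> card (orb ?w)" .
  have 2: "card (orb (aword ss)) \<le> card (orb (tr True ?w))"
    using orb_theta[OF assms] by (intro card_mono) auto
  have "card (orb (aword ss)) \<le> card (orb (GA # tr False ?w))"
    using orb_theta[OF assms] by (intro card_mono finite_orb) blast
  also have "\<dots> \<le> card (orb (tr False ?w)) + 1" by (rule card_orb_Cons)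
  finally show ?thesis using 1 2 card_orb_snoc[of "aword ss"] by simp
qed

text \<open>An eigenvector of the substitution for the eigenvalue 2 / \<eta>; its equation at b is
  the defining equation of \<eta>.\<close>

fun wt :: "gen \<Rightarrow> real" where
  "wt GB = 1 / eta ^ 2" | "wt GC = 1 / eta" | "wt GD = 1" | "wt GA = 0"

lemma sum_wt_theta1: "s \<noteq> GA \<Longrightarrow> sum_list (map wt (theta1 s)) = 2 / eta * wt s"
proof (cases s)
  case GB
  have "1 / eta ^ 2 + (1 + 1 / eta) = 2 / eta * (1 / eta ^ 2)"
    using eta_root eta_pos by (simp add: field_simps power2_eq_square power3_eq_cube)
  thus ?thesis using GB by simp
qed (use eta_pos in \<open>auto simp: field_simps power2_eq_square\<close>)

lemma sum_wt_theta:
  "GA \<notin> set ss \<Longrightarrow> sum_list (map wt (theta ss)) = 2 / eta * sum_list (map wt ss)"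
  by (induction ss) (auto simp: sum_wt_theta1 distrib_left)

lemma length_le_sum_wt: "GA \<notin> set ss \<Longrightarrow> real (length ss) \<le> sum_list (map wt ss)"
proof (induction ss)
  case (Cons s ss)
  have "1 \<le> wt s" using Cons.prems eta_pos eta_lt_1 by (cases s) (auto simp: power_le_one)
  thus ?case using Cons by auto
qed simp

lemma long_orbits:
  "\<exists>C>0. \<forall>j. \<exists>w. real (length w) \<le> C * (2 / eta) ^ j \<and> 2 ^ j \<le> card (orb w)"
proof -
  define Lj where "Lj = (\<lambda>j. (theta ^^ j) [GB, GC])"
  have V: "GA \<notin> set (Lj j)" for j
    by (cases j) (auto simp: Lj_def GA_notin_theta)
  \<comment> \<open>The recursion x \<mapsto> 2 x - 3 fixes 3, so the excess over 3 doubles. The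
    seed a b a c a has at least 4 points and thus starts above the fixed point.\<close>
  have card: "2 ^ j + 3 \<le> card (orb (aword (Lj j) @ [GA]))" for j
  proof (induction j)
    case 0
    let ?A = "{rho, scons False rho, scons True (scons False rho),
        scons False (scons False (scons False rho))}"
    have "?A \<subseteq> orb (aword (Lj 0) @ [GA])"
      by (auto simp: Lj_def gen_act_GA_rho)
    hence "card ?A \<le> card (orb (aword (Lj 0) @ [GA]))" by (intro card_mono) auto
    moreover have "card ?A = 4"
      by (simp add: card_insert_if)
    ultimately show ?case by simp
  next
    case (Suc j)
    have "2 * card (orb (aword (Lj j) @ [GA])) \<le> card (orb (aword (Lj (Suc j)) @ [GA])) + 3"
      using card_orb_theta[OF V[of j]] by (simp add: Lj_def)
    thus ?case using Suc by simp
  qed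
  have wt: "sum_list (map wt (Lj j)) = sum_list (map wt [GB, GC]) * (2 / eta) ^ j" for j
  proof (induction j)
    case (Suc j)
    thus ?case using sum_wt_theta[OF V[of j]] by (simp add: Lj_def)
  qed (simp add: Lj_def)
  define D where "D = sum_list (map wt [GB, GC])"
  have D: "D > 0" using eta_pos by (simp add: D_def add_pos_pos)
  have "real (length (aword (Lj j) @ [GA])) \<le> (2 * D + 1) * (2 / eta) ^ j" for j
  proof -
    have "1 \<le> (2 / eta) ^ j" using eta_pos eta_lt_1 by (intro one_le_power) auto
    moreover have "real (length (Lj j)) \<le> D * (2 / eta) ^ j"
      using length_le_sum_wt[OF V[of j]] wt[of j] by (simp add: D_def)
    ultimately show ?thesis by (simp add: length_aword distrib_right)
  qed
  moreover have "2 ^ j \<le> card (orb (aword (Lj j) @ [GA]))" for j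
    using card[of j] by simp
  moreover have "0 < 2 * D + 1" using D by simp
  ultimately show ?thesis by blast
qed

section \<open>Balls in finitely generated groups\<close>

context group
begin

lemma ball_0: "ball G S 0 = {\<one>}"
  by (auto simp: ball_def)

lemma ball_Suc:
  "ball G S (Suc n) = insert \<one> {s \<otimes> x | s x. s \<in> S \<union> m_inv G ` S \<and> x \<in> ball G S n}"
proof
  show "ball G S (Suc n) \<subseteq> insert \<one> {s \<otimes> x | s x. s \<in> S \<union> m_inv G ` S \<and> x \<in> ball G S n}"
  proof
    fix z assume "z \<in> ball G S (Suc n)"
    then obtain ws where ws: "z = foldr (\<otimes>) ws \<one>" "length ws \<le> Suc n" "set ws \<subseteq> S \<union> m_inv G ` S"
      by (auto simp: ball_def)
    show "z \<in> insert \<one> {s \<otimes> x | s x. s \<in> S \<union> m_inv G ` S \<and> x \<in> ball G S n}"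
    proof (cases ws)
      case (Cons s vs)
      hence "foldr (\<otimes>) vs \<one> \<in> ball G S n" using ws by (auto simp: ball_def)
      thus ?thesis using Cons ws by auto
    qed (use ws in simp)
  qed
  show "insert \<one> {s \<otimes> x | s x. s \<in> S \<union> m_inv G ` S \<and> x \<in> ball G S n} \<subseteq> ball G S (Suc n)"
  proof
    fix z assume "z \<in> insert \<one> {s \<otimes> x | s x. s \<in> S \<union> m_inv G ` S \<and> x \<in> ball G S n}"
    then consider "z = \<one>" | s x where "z = s \<otimes> x" "s \<in> S \<union> m_inv G ` S" "x \<in> ball G S n" by blast
    thus "z \<in> ball G S (Suc n)"
    proof cases
      case 1
      thus ?thesis by (auto simp: ball_def intro!: exI[of _ "[]"])
    next
      case 2
      from 2(3) obtain ws where "x = foldr (\<otimes>) ws \<one>" "length ws \<le> n" "set ws \<subseteq> S \<union> m_inv G ` S"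
        by (auto simp: ball_def)
      thus ?thesis using 2 by (auto simp: ball_def intro!: exI[of _ "s # ws"])
    qed
  qed
qed

lemma one_in_ball: "\<one> \<in> ball G S n"
  by (cases n) (auto simp: ball_0 ball_Suc)

lemma ball_mono: "m \<le> n \<Longrightarrow> ball G S m \<subseteq> ball G S n"
  by (auto simp: ball_def)

lemma finite_ball: "finite S \<Longrightarrow> finite (ball G S n)"
proof (induction n)
  case (Suc n)
  have "{s \<otimes> x | s x. s \<in> S \<union> m_inv G ` S \<and> x \<in> ball G S n}
      = (\<lambda>(s, x). s \<otimes> x) ` ((S \<union> m_inv G ` S) \<times> ball G S n)" by auto
  thus ?case using Suc by (simp add: ball_Suc)
qed (simp add: ball_0)

lemma card_ball_pos: "finite S \<Longrightarrow> 1 \<le> card (ball G S n)"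
  using card_gt_0_iff[of "ball G S n"] one_in_ball[of S n] finite_ball[of S n]
  by (metis One_nat_def Suc_leI empty_iff)

lemma ball_subset_carrier: "S \<subseteq> carrier G \<Longrightarrow> ball G S n \<subseteq> carrier G"
  by (induction n) (auto simp: ball_0 ball_Suc)

lemma ball_subset_generate: "ball G S n \<subseteq> generate G S"
proof (induction n)
  case (Suc n)
  show ?case using Suc
    by (auto simp: ball_Suc intro!: generate.intros(1) generate.eng
        intro: generate.incl generate.inv)
qed (auto simp: ball_0 intro: generate.one)

lemma gen_in_ball:
  assumes "S \<subseteq> carrier G" "s \<in> S \<union> m_inv G ` S"
  shows "s \<in> ball G S 1"
proof -
  have "s \<in> carrier G" using assms by auto
  hence "s = s \<otimes> \<one>" by simp
  hence "s \<in> ball G S (Suc 0)" unfolding ball_Suc ball_0 using assms by blast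
  thus ?thesis by simp
qed

lemma ball_mult:
  assumes "S \<subseteq> carrier G" "x \<in> ball G S m" "y \<in> ball G S n"
  shows "x \<otimes> y \<in> ball G S (m + n)"
  using assms(2)
proof (induction m arbitrary: x)
  case 0
  have "y \<in> carrier G" using assms ball_subset_carrier by blast
  thus ?case using 0 assms(3) by (simp add: ball_0)
next
  case (Suc m)
  have y: "y \<in> carrier G" using assms ball_subset_carrier by blast
  consider "x = \<one>" | s z where "x = s \<otimes> z" "s \<in> S \<union> m_inv G ` S" "z \<in> ball G S m"
    using Suc.prems by (auto simp: ball_Suc)
  thus ?case
  proof cases
    case 1
    thus ?thesis using assms(3) y ball_mono[of n "Suc m + n" S] by auto
  next
    case 2
    have "s \<in> carrier G" "z \<in> carrier G" using 2 assms ball_subset_carrier by auto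
    hence "x \<otimes> y = s \<otimes> (z \<otimes> y)" using 2 y by (simp add: m_assoc)
    thus ?thesis using 2 Suc.IH by (auto simp: ball_Suc)
  qed
qed

lemma ball_inv:
  assumes "S \<subseteq> carrier G" "x \<in> ball G S n"
  shows "inv x \<in> ball G S n"
  using assms(2)
proof (induction n arbitrary: x)
  case (Suc n)
  consider "x = \<one>" | s z where "x = s \<otimes> z" "s \<in> S \<union> m_inv G ` S" "z \<in> ball G S n"
    using Suc.prems by (auto simp: ball_Suc)
  thus ?case
  proof cases
    case 2
    have c: "s \<in> carrier G" "z \<in> carrier G" using 2 assms ball_subset_carrier by auto
    have "inv s \<in> S \<union> m_inv G ` S" using 2 assms(1) by auto
    hence "inv z \<otimes> inv s \<in> ball G S (n + 1)"
      using Suc.IH[OF 2(3)] assms(1) by (intro ball_mult gen_in_ball)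
    thus ?thesis using 2 c by (simp add: inv_mult_group)
  qed (auto simp: one_in_ball)
qed (auto simp: ball_0)

lemma generate_subset_ball:
  assumes "S \<subseteq> carrier G" "x \<in> generate G S"
  shows "\<exists>n. x \<in> ball G S n"
  using assms(2)
proof induction
  case one
  show ?case by (rule exI, rule one_in_ball)
next
  case (incl h)
  thus ?case by (intro exI[of _ 1] gen_in_ball[OF assms(1)]) simp
next
  case (inv h)
  thus ?case by (intro exI[of _ 1] gen_in_ball[OF assms(1)]) simp
next
  case (eng h1 h2)
  then obtain m n where "h1 \<in> ball G S m" "h2 \<in> ball G S n" by blast
  hence "h1 \<otimes> h2 \<in> ball G S (m + n)" by (rule ball_mult[OF assms(1)])
  thus ?case by blast
qed

lemma ball_subset_ball:
  assumes "S \<subseteq> carrier G" "T \<subseteq> ball G S q"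
  shows "ball G T n \<subseteq> ball G S (q * n)"
proof (induction n)
  case (Suc n)
  have "s \<otimes> x \<in> ball G S (q * Suc n)" if "s \<in> T \<union> m_inv G ` T" "x \<in> ball G T n" for s x
  proof -
    have "s \<in> ball G S q" using that assms ball_inv[OF assms(1)] by auto
    moreover have "x \<in> ball G S (q * n)" using Suc that by blast
    ultimately show ?thesis using ball_mult[OF assms(1)] by auto
  qed
  thus ?case by (auto simp: ball_Suc one_in_ball)
qed (simp add: ball_0)

lemma finite_subset_ball:
  assumes "S \<subseteq> carrier G" "finite T" "T \<subseteq> generate G S"
  shows "\<exists>q\<ge>1. T \<subseteq> ball G S q"
  using assms(2,3)
proof (induction T)
  case empty
  show ?case by (rule exI[of _ 1]) simp
next
  case (insert t T)
  then obtain q where q: "q \<ge> 1" "T \<subseteq> ball G S q" by blast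
  obtain m where m: "t \<in> ball G S m" using generate_subset_ball[OF assms(1)] insert.prems by blast
  have "ball G S q \<subseteq> ball G S (max q m)" "ball G S m \<subseteq> ball G S (max q m)"
    by (simp_all add: ball_mono)
  hence "insert t T \<subseteq> ball G S (max q m)" using q m by blast
  thus ?case using q by (intro exI[of _ "max q m"]) simp
qed

text \<open>Reduces any generating set to a standard one: each element of \<open>T\<close> is a word
  of bounded length over \<open>S\<close>, and growth is compared only up to rescaling
  lengths.\<close>

lemma change_generators:
  assumes "finite S" "S \<subseteq> carrier G" "finite T" "T \<subseteq> generate G S"
  shows "\<exists>q\<ge>1. \<forall>n. card (ball G T n) \<le> card (ball G S (q * n))"
proof -
  obtain q where q: "q \<ge> 1" "T \<subseteq> ball G S q"
    using finite_subset_ball[OF assms(2,3,4)] by blast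
  have "card (ball G T n) \<le> card (ball G S (q * n))" for n
    by (rule card_mono[OF finite_ball[OF assms(1)] ball_subset_ball[OF assms(2) q(2)]])
  thus ?thesis using q(1) by blast
qed

end

section \<open>Permutational wreath products\<close>

text \<open>One step of the recursion for \<open>L\<close> over an arbitrary lamp group, so that a
  step can be analysed once and then iterated.\<close>

definition Wr :: "W monoid \<Rightarrow> W monoid" where
  "Wr G =
     \<lparr>carrier = {WEl f g | f g. g \<in> Grig
                   \<and> (\<forall>x\<in>Xorb. f x \<in> carrier G)
                   \<and> (\<forall>x. x \<notin> Xorb \<longrightarrow> f x = one G)
                   \<and> finite {x \<in> Xorb. f x \<noteq> one G}},
      mult = (\<lambda>p q. WEl (\<lambda>x. if x \<in> Xorb
                                then mult G (wfun p x) (wfun q (wperm p x))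
                                else one G)
                         (wperm q \<circ> wperm p)),
      one = WEl (\<lambda>_. one G) id\<rparr>"

lemma L_Suc: "L (Suc k) = Wr (L k)"
  by (simp add: Wr_def)

lemma Wr_mult: "WEl f g \<otimes>\<^bsub>Wr G\<^esub> WEl f' g' =
    WEl (\<lambda>x. if x \<in> Xorb then f x \<otimes>\<^bsub>G\<^esub> f' (g x) else \<one>\<^bsub>G\<^esub>) (g' \<circ> g)"
  by (simp add: Wr_def cong: if_cong)

lemma Wr_one: "\<one>\<^bsub>Wr G\<^esub> = WEl (\<lambda>_. \<one>\<^bsub>G\<^esub>) id"
  by (simp add: Wr_def)

definition lamps :: "W monoid \<Rightarrow> (seq \<Rightarrow> W) set" where
  "lamps G = {f. (\<forall>x\<in>Xorb. f x \<in> carrier G) \<and> (\<forall>x. x \<notin> Xorb \<longrightarrow> f x = \<one>\<^bsub>G\<^esub>)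
                 \<and> finite {x \<in> Xorb. f x \<noteq> \<one>\<^bsub>G\<^esub>}}"

lemma WEl_in_carrier: "WEl f g \<in> carrier (Wr G) \<longleftrightarrow> f \<in> lamps G \<and> g \<in> Grig"
  by (auto simp: Wr_def lamps_def)

lemma carrier_Wr_cases:
  assumes "z \<in> carrier (Wr G)"
  obtains f g where "z = WEl f g" "f \<in> lamps G" "g \<in> Grig"
  using assms by (auto simp: Wr_def lamps_def)

lemma bij_Grig: "g \<in> Grig \<Longrightarrow> bij g"
  using bij_ev by (auto simp: Grig_eq)

lemma Xorb_eq: "Xorb = range (\<lambda>w. ev w rho)"
  by (auto simp: Xorb_def Grig_eq)

lemma rho_in_Xorb [simp]: "rho \<in> Xorb"
  unfolding Xorb_eq by (rule range_eqI[of _ _ "[]"]) simp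

lemma Grig_Xorb_iff:
  assumes "g \<in> Grig"
  shows "g x \<in> Xorb \<longleftrightarrow> x \<in> Xorb"
proof -
  have 1: "ev v x \<in> Xorb" if x: "x \<in> Xorb" for v x
  proof -
    obtain u where "x = ev u rho" using x unfolding Xorb_eq by blast
    hence "ev v x = ev (v @ u) rho" by (simp add: ev_append)
    thus ?thesis unfolding Xorb_eq by (rule range_eqI)
  qed
  obtain v where v: "g = ev v" using assms by (auto simp: Grig_eq)
  show ?thesis using 1[of x v] 1[of "g x" "rev v"] by (auto simp: v ev_rev_ev)
qed

text \<open>The word runs along w, back along \<open>rev w\<close>, and then to the new point: its
  prefix w keeps the old points, and the whole word evaluates like the last segment.\<close>

lemma finite_orb_cover:
  assumes "finite F" "F \<subseteq> Xorb"
  shows "\<exists>w. F \<subseteq> orb w"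
  using assms
proof (induction F)
  case (insert x F)
  then obtain w where w: "F \<subseteq> orb w" by auto
  obtain u where u: "x = ev u rho" using insert.prems by (auto simp: Xorb_eq)
  have "ev (w @ rev w @ u) rho = x" by (simp add: ev_append ev_ev_rev u)
  hence "x \<in> orb (w @ rev w @ u)" using ev_rho_in_orb by metis
  moreover have "F \<subseteq> orb (w @ rev w @ u)" using w by (auto simp: orb_append)
  ultimately show ?case by blast
qed simp

lemma card_UN_le_mult:
  fixes b :: real
  assumes "finite A" "\<And>p. p \<in> A \<Longrightarrow> real (card (F p)) \<le> b"
  shows "real (card (\<Union>p\<in>A. F p)) \<le> real (card A) * b"
proof -
  have "real (card (\<Union>p\<in>A. F p)) \<le> real (\<Sum>p\<in>A. card (F p))"
    using card_UN_le[OF assms(1), of F] by (simp only: of_nat_le_iff)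
  also have "\<dots> = (\<Sum>p\<in>A. real (card (F p)))" by simp
  also have "\<dots> \<le> real (card A) * b" using assms(2) by (rule sum_bounded_above)
  finally show ?thesis .
qed

section \<open>Standard generators of the wreath product\<close>

definition lamp :: "W monoid \<Rightarrow> W \<Rightarrow> W" where
  "lamp G t = WEl ((\<lambda>_. \<one>\<^bsub>G\<^esub>)(rho := t)) id"

definition mover :: "W monoid \<Rightarrow> (seq \<Rightarrow> seq) \<Rightarrow> W" where
  "mover G g = WEl (\<lambda>_. \<one>\<^bsub>G\<^esub>) g"

definition wr_gens :: "W monoid \<Rightarrow> W set \<Rightarrow> W set" where
  "wr_gens G S = lamp G ` S \<union> mover G ` range gen_act"

locale lamp_group = group G for G :: "W monoid" (structure)
begin

lemma lamps_I:
  assumes "\<And>x. x \<in> Xorb \<Longrightarrow> f x \<in> carrier G" "\<And>x. x \<notin> Xorb \<Longrightarrow> f x = \<one>"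
    "{x. f x \<noteq> \<one>} \<subseteq> F" "finite F"
  shows "f \<in> lamps G"
  using assms finite_subset[of "{x \<in> Xorb. f x \<noteq> \<one>}" F] by (auto simp: lamps_def)

lemma lamps_finite: "f \<in> lamps G \<Longrightarrow> finite {x. f x \<noteq> \<one>}"
  by (rule finite_subset[of _ "{x \<in> Xorb. f x \<noteq> \<one>}"]) (auto simp: lamps_def)

lemma lamps_closed: "f \<in> lamps G \<Longrightarrow> f x \<in> carrier G"
  by (cases "x \<in> Xorb") (auto simp: lamps_def)

lemma lamps_off: "f \<in> lamps G \<Longrightarrow> x \<notin> Xorb \<Longrightarrow> f x = \<one>"
  by (auto simp: lamps_def)

lemma group_Wr: "group (Wr G)"
proof (rule groupI)
  fix p q assume "p \<in> carrier (Wr G)" "q \<in> carrier (Wr G)"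
  obtain f g where p: "p = WEl f g" "f \<in> lamps G" "g \<in> Grig"
    using \<open>p \<in> carrier (Wr G)\<close> by (rule carrier_Wr_cases)
  obtain f' g' where q: "q = WEl f' g'" "f' \<in> lamps G" "g' \<in> Grig"
    using \<open>q \<in> carrier (Wr G)\<close> by (rule carrier_Wr_cases)
  have "(\<lambda>x. if x \<in> Xorb then f x \<otimes> f' (g x) else \<one>) \<in> lamps G"
  proof (rule lamps_I)
    show "{x. (if x \<in> Xorb then f x \<otimes> f' (g x) else \<one>) \<noteq> \<one>}
        \<subseteq> {x. f x \<noteq> \<one>} \<union> g -` {x. f' x \<noteq> \<one>}" by auto
    show "finite ({x. f x \<noteq> \<one>} \<union> g -` {x. f' x \<noteq> \<one>})"
      by (intro finite_UnI finite_vimageI lamps_finite p q bij_is_inj bij_Grig)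
  qed (use lamps_closed p q in auto)
  thus "p \<otimes>\<^bsub>Wr G\<^esub> q \<in> carrier (Wr G)"
    using p q by (simp add: Wr_mult WEl_in_carrier Grig_mult)
next
  show "\<one>\<^bsub>Wr G\<^esub> \<in> carrier (Wr G)"
    using Grig_id by (auto simp: Wr_one WEl_in_carrier lamps_def)
next
  fix p q r assume "p \<in> carrier (Wr G)" "q \<in> carrier (Wr G)" "r \<in> carrier (Wr G)"
  obtain f g where p: "p = WEl f g" "f \<in> lamps G" "g \<in> Grig"
    using \<open>p \<in> carrier (Wr G)\<close> by (rule carrier_Wr_cases)
  obtain f' g' where q: "q = WEl f' g'" "f' \<in> lamps G" "g' \<in> Grig"
    using \<open>q \<in> carrier (Wr G)\<close> by (rule carrier_Wr_cases)
  obtain f'' g'' where r: "r = WEl f'' g''" "f'' \<in> lamps G" "g'' \<in> Grig"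
    using \<open>r \<in> carrier (Wr G)\<close> by (rule carrier_Wr_cases)
  show "p \<otimes>\<^bsub>Wr G\<^esub> q \<otimes>\<^bsub>Wr G\<^esub> r = p \<otimes>\<^bsub>Wr G\<^esub> (q \<otimes>\<^bsub>Wr G\<^esub> r)"
    using p q r by (auto simp: Wr_mult fun_eq_iff Grig_Xorb_iff lamps_closed m_assoc)
next
  fix p assume "p \<in> carrier (Wr G)"
  then obtain f g where p: "p = WEl f g" "f \<in> lamps G" "g \<in> Grig" by (rule carrier_Wr_cases)
  show "\<one>\<^bsub>Wr G\<^esub> \<otimes>\<^bsub>Wr G\<^esub> p = p"
    using p by (auto simp: Wr_mult Wr_one fun_eq_iff lamps_closed lamps_off)
  define h where "h = inv_into UNIV g"
  have h: "g (h x) = x" for x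
    unfolding h_def by (rule surj_f_inv_f[OF bij_is_surj[OF bij_Grig[OF p(3)]]])
  have hG: "h \<in> Grig" unfolding h_def by (rule Grig_inv[OF p(3)])
  define f' where "f' = (\<lambda>x. if x \<in> Xorb then m_inv G (f (h x)) else \<one>)"
  have "f' \<in> lamps G"
  proof (rule lamps_I)
    show "{x. f' x \<noteq> \<one>} \<subseteq> g ` {x. f x \<noteq> \<one>}"
    proof
      fix x assume "x \<in> {x. f' x \<noteq> \<one>}"
      hence "f (h x) \<noteq> \<one>" by (auto simp: f'_def split: if_splits)
      thus "x \<in> g ` {x. f x \<noteq> \<one>}" using h[of x] by (intro image_eqI[of _ _ "h x"]) simp_all
    qed
  qed (use p lamps_finite lamps_closed in \<open>auto simp: f'_def\<close>)
  moreover have "WEl f' h \<otimes>\<^bsub>Wr G\<^esub> p = \<one>\<^bsub>Wr G\<^esub>"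
  proof -
    have "(\<lambda>x. if x \<in> Xorb then f' x \<otimes> f (h x) else \<one>) = (\<lambda>_. \<one>)"
      by (rule ext) (use lamps_closed[OF p(2)] in \<open>auto simp: f'_def\<close>)
    moreover have "g \<circ> h = id" by (rule ext) (simp add: h)
    ultimately show ?thesis by (simp only: p(1) Wr_mult Wr_one)
  qed
  ultimately show "\<exists>y\<in>carrier (Wr G). y \<otimes>\<^bsub>Wr G\<^esub> p = \<one>\<^bsub>Wr G\<^esub>"
    using hG by (intro bexI[of _ "WEl f' h"]) (simp_all only: WEl_in_carrier simp_thms)
qed

lemma lamp_in_carrier: "t \<in> carrier G \<Longrightarrow> lamp G t \<in> carrier (Wr G)"
  unfolding lamp_def WEl_in_carrier
  by (auto intro!: lamps_I[of _ "{rho}"] Grig_id split: if_splits)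

lemma mover_in_carrier: "g \<in> Grig \<Longrightarrow> mover G g \<in> carrier (Wr G)"
  unfolding mover_def WEl_in_carrier by (auto simp: lamps_def)

text \<open>A lamp letter on the left touches only the value at \<open>rho\<close>, while a mover
  shifts the whole configuration. These are the two clauses in the recursion for
  \<open>orb\<close>.\<close>

lemma lamp_mult:
  assumes "f \<in> lamps G" "t \<in> carrier G"
  shows "lamp G t \<otimes>\<^bsub>Wr G\<^esub> WEl f g = WEl (f(rho := t \<otimes> f rho)) g"
proof -
  have "(\<lambda>x. if x \<in> Xorb then ((\<lambda>_. \<one>)(rho := t)) x \<otimes> f (id x) else \<one>) = f(rho := t \<otimes> f rho)"
    by (rule ext) (use assms in \<open>auto simp: lamps_closed lamps_off\<close>)
  thus ?thesis by (simp only: lamp_def Wr_mult comp_id)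
qed

lemma mover_mult:
  assumes "f \<in> lamps G" "g' \<in> Grig"
  shows "mover G g' \<otimes>\<^bsub>Wr G\<^esub> WEl f g = WEl (\<lambda>x. f (g' x)) (g \<circ> g')"
proof -
  have "(\<lambda>x. if x \<in> Xorb then \<one> \<otimes> f (g' x) else \<one>) = (\<lambda>x. f (g' x))"
    by (rule ext) (use assms in \<open>simp add: lamps_closed lamps_off Grig_Xorb_iff\<close>)
  thus ?thesis by (simp only: mover_def Wr_mult)
qed

lemma wr_gens_subset: "S \<subseteq> carrier G \<Longrightarrow> wr_gens G S \<subseteq> carrier (Wr G)"
  using lamp_in_carrier mover_in_carrier[OF Grig_gen] by (auto simp: wr_gens_def)

lemma finite_wr_gens: "finite S \<Longrightarrow> finite (wr_gens G S)"
proof -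
  have "s \<in> {GA, GB, GC, GD}" for s by (cases s) simp_all
  hence "finite (UNIV :: gen set)" by (intro finite_subset[of UNIV "{GA, GB, GC, GD}"]) auto
  thus "finite S \<Longrightarrow> finite (wr_gens G S)" unfolding wr_gens_def by simp
qed

lemma inv_lamp: "t \<in> carrier G \<Longrightarrow> m_inv (Wr G) (lamp G t) = lamp G (inv t)"
proof -
  interpret W: group "Wr G" by (rule group_Wr)
  assume t: "t \<in> carrier G"
  have "lamp G (inv t) \<otimes>\<^bsub>Wr G\<^esub> lamp G t = \<one>\<^bsub>Wr G\<^esub>"
  proof -
    have "(\<lambda>x. if x \<in> Xorb then ((\<lambda>_. \<one>)(rho := inv t)) x \<otimes> ((\<lambda>_. \<one>)(rho := t)) (id x) else \<one>)
        = (\<lambda>_. \<one>)"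
      by (rule ext) (use t in simp)
    thus ?thesis by (simp only: lamp_def Wr_mult Wr_one comp_id)
  qed
  thus ?thesis using t by (intro W.inv_equality) (auto intro: lamp_in_carrier)
qed

lemma inv_mover: "m_inv (Wr G) (mover G (gen_act s)) = mover G (gen_act s)"
proof -
  interpret W: group "Wr G" by (rule group_Wr)
  have "gen_act s \<circ> gen_act s = id" by (rule ext) simp
  hence "mover G (gen_act s) \<otimes>\<^bsub>Wr G\<^esub> mover G (gen_act s) = \<one>\<^bsub>Wr G\<^esub>"
    by (simp add: mover_def Wr_mult Wr_one cong: if_cong del: comp_apply)
  thus ?thesis by (intro W.inv_equality) (auto intro: mover_in_carrier Grig_gen)
qed

lemma wr_gens_sym:
  assumes "S \<subseteq> carrier G"
  shows "wr_gens G S \<union> m_inv (Wr G) ` wr_gens G S =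
     lamp G ` (S \<union> m_inv G ` S) \<union> mover G ` range gen_act"
proof -
  have "m_inv (Wr G) ` lamp G ` S = lamp G ` m_inv G ` S"
    unfolding image_image by (rule image_cong[OF refl], rule inv_lamp, rule subsetD[OF assms])
  moreover have "m_inv (Wr G) ` mover G ` range gen_act = mover G ` range gen_act"
    unfolding image_image by (rule image_cong[OF refl], rule inv_mover)
  ultimately have "m_inv (Wr G) ` wr_gens G S = lamp G ` m_inv G ` S \<union> mover G ` range gen_act"
    unfolding wr_gens_def image_Un by (simp only:)
  thus ?thesis by (simp only: wr_gens_def image_Un Un_ac Un_absorb Un_left_absorb)
qed

text \<open>Here \<open>w\<close> lists the letters of \<Gamma> in the product and
  \<open>r x\<close> counts the lamp letters that land at \<open>x\<close>. Functions compose in the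
  order opposite to the group product, hence \<open>rev w\<close>.\<close>

lemma wr_ball_shape:
  assumes S: "S \<subseteq> carrier G" and z: "z \<in> ball (Wr G) (wr_gens G S) n"
  shows "\<exists>w f r. z = WEl f (ev (rev w)) \<and> length w \<le> n \<and> (\<forall>x. f x \<in> ball G S (r x))
      \<and> (\<forall>x. x \<notin> orb w \<longrightarrow> r x = 0) \<and> sum r (orb w) \<le> n"
  using z
proof (induction n arbitrary: z)
  interpret W: group "Wr G" by (rule group_Wr)
  {
    case 0
    hence "z = WEl (\<lambda>_. \<one>) (ev (rev []))" by (simp add: W.ball_0 Wr_one)
    thus ?case by (intro exI[of _ "[]"] exI[of _ "\<lambda>_. \<one>"] exI[of _ "\<lambda>_. 0"])
        (auto simp: ball_0)
  next
    case (Suc n)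
    consider "z = \<one>\<^bsub>Wr G\<^esub>"
      | t z' where "z = lamp G t \<otimes>\<^bsub>Wr G\<^esub> z'" "t \<in> S \<union> m_inv G ` S" "z' \<in> ball (Wr G) (wr_gens G S) n"
      | s z' where "z = mover G (gen_act s) \<otimes>\<^bsub>Wr G\<^esub> z'" "z' \<in> ball (Wr G) (wr_gens G S) n"
      using Suc.prems unfolding W.ball_Suc wr_gens_sym[OF S] by blast
    thus ?case
    proof cases
      case 1
      hence "z = WEl (\<lambda>_. \<one>) (ev (rev []))" by (simp add: Wr_one)
      thus ?thesis by (intro exI[of _ "[]"] exI[of _ "\<lambda>_. \<one>"] exI[of _ "\<lambda>_. 0"])
          (auto simp: ball_0)
    next
      case 2
      obtain w f r where w: "z' = WEl f (ev (rev w))" "length w \<le> n" "\<And>x. f x \<in> ball G S (r x)"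
        "\<And>x. x \<notin> orb w \<Longrightarrow> r x = 0" "sum r (orb w) \<le> n"
        using Suc.IH[OF 2(3)] by blast
      have f: "f \<in> lamps G"
        using W.ball_subset_carrier[OF wr_gens_subset[OF S], of n] 2(3) w(1) WEl_in_carrier by blast
      have t: "t \<in> carrier G" using 2(2) S by auto
      have "z = WEl (f(rho := t \<otimes> f rho)) (ev (rev w))"
        using 2(1) w(1) lamp_mult[OF f t] by simp
      moreover have "(f(rho := t \<otimes> f rho)) x \<in> ball G S ((r(rho := Suc (r rho))) x)" for x
        using w(3)[of x] w(3)[of rho] 2(2) by (auto simp: ball_Suc)
      moreover have "sum (r(rho := Suc (r rho))) (orb w) = Suc (sum r (orb w))"
        by (simp add: sum.remove[of "orb w" rho])
      ultimately show ?thesis using w(2,4,5) rho_in_orb[of w]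
        by (intro exI[of _ w] exI[of _ "f(rho := t \<otimes> f rho)"] exI[of _ "r(rho := Suc (r rho))"]) auto
    next
      case 3
      obtain w f r where w: "z' = WEl f (ev (rev w))" "length w \<le> n" "\<And>x. f x \<in> ball G S (r x)"
        "\<And>x. x \<notin> orb w \<Longrightarrow> r x = 0" "sum r (orb w) \<le> n"
        using Suc.IH[OF 3(2)] by blast
      have f: "f \<in> lamps G"
        using W.ball_subset_carrier[OF wr_gens_subset[OF S], of n] 3(2) w(1) WEl_in_carrier by blast
      have z: "z = WEl (\<lambda>x. f (gen_act s x)) (ev (rev (s # w)))"
        using 3(1) w(1) mover_mult[OF f Grig_gen] by (simp add: ev_append comp_def)
      have off: "r (gen_act s x) = 0" if "x \<notin> orb (s # w)" for x
      proof (rule w(4))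
        show "gen_act s x \<notin> orb w"
        proof
          assume "gen_act s x \<in> orb w"
          hence "gen_act s (gen_act s x) \<in> gen_act s ` orb w" by (rule imageI)
          thus False using that by simp
        qed
      qed
      \<comment> \<open>If \<open>rho\<close> is new in the orbit, its budget is 0, because its
        image under \<open>s\<close> lies outside \<open>orb w\<close>.\<close>
      have "(\<Sum>x\<in>orb (s # w). r (gen_act s x)) = (\<Sum>x\<in>gen_act s ` orb w. r (gen_act s x))"
      proof (rule sum.mono_neutral_right)
        show "\<forall>x\<in>orb (s # w) - gen_act s ` orb w. r (gen_act s x) = 0"
        proof
          fix x assume x: "x \<in> orb (s # w) - gen_act s ` orb w"
          have "gen_act s x \<notin> orb w"
          proof
            assume "gen_act s x \<in> orb w"
            hence "gen_act s (gen_act s x) \<in> gen_act s ` orb w" by (rule imageI)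
            thus False using x by simp
          qed
          thus "r (gen_act s x) = 0" by (rule w(4))
        qed
      qed auto
      also have "\<dots> = sum r (orb w)"
        by (subst sum.reindex) (auto intro: inj_on_subset[OF bij_is_inj[OF bij_gen_act]])
      finally have "(\<Sum>x\<in>orb (s # w). r (gen_act s x)) \<le> Suc n" using w(5) by simp
      thus ?thesis using z w(2,3) off
        by (intro exI[of _ "s # w"] exI[of _ "\<lambda>x. f (gen_act s x)"] exI[of _ "\<lambda>x. r (gen_act s x)"])
          (auto simp del: orb.simps)
    qed
  }
qed

lemma wr_ball_lamp:
  assumes S: "S \<subseteq> carrier G" and z: "WEl f g \<in> ball (Wr G) (wr_gens G S) m"
    and t: "t \<in> ball G S r"
  shows "WEl (f(rho := t \<otimes> f rho)) g \<in> ball (Wr G) (wr_gens G S) (r + m)"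
proof -
  interpret W: group "Wr G" by (rule group_Wr)
  have car: "f' \<in> lamps G" if "WEl f' g' \<in> ball (Wr G) (wr_gens G S) k" for f' g' k
    using W.ball_subset_carrier[OF wr_gens_subset[OF S], of k] that WEl_in_carrier by blast
  have f: "f rho \<in> carrier G" using car[OF z] lamps_closed by blast
  show ?thesis using t
  proof (induction r arbitrary: t)
    case 0
    thus ?case using z f by (simp add: ball_0)
  next
    case (Suc r)
    consider "t = \<one>" | u t' where "t = u \<otimes> t'" "u \<in> S \<union> m_inv G ` S" "t' \<in> ball G S r"
      using Suc.prems by (auto simp: ball_Suc)
    thus ?case
    proof cases
      case 1
      have "ball (Wr G) (wr_gens G S) m \<subseteq> ball (Wr G) (wr_gens G S) (Suc r + m)"
        by (rule W.ball_mono) simp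
      thus ?thesis using z f 1 by auto
    next
      case 2
      have c: "u \<in> carrier G" "t' \<in> carrier G" using 2 S ball_subset_carrier by auto
      have ih: "WEl (f(rho := t' \<otimes> f rho)) g \<in> ball (Wr G) (wr_gens G S) (r + m)"
        using Suc.IH[OF 2(3)] .
      have "lamp G u \<in> wr_gens G S \<union> m_inv (Wr G) ` wr_gens G S"
        using 2(2) unfolding wr_gens_sym[OF S] by blast
      hence "lamp G u \<otimes>\<^bsub>Wr G\<^esub> WEl (f(rho := t' \<otimes> f rho)) g \<in> ball (Wr G) (wr_gens G S) (Suc (r + m))"
        using ih unfolding W.ball_Suc by blast
      moreover have "lamp G u \<otimes>\<^bsub>Wr G\<^esub> WEl (f(rho := t' \<otimes> f rho)) g = WEl (f(rho := t \<otimes> f rho)) g"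
        unfolding lamp_mult[OF car[OF ih] c(1)] 2(1) using c f by (simp add: m_assoc)
      ultimately show ?thesis by (simp only: add_Suc)
    qed
  qed
qed

text \<open>Each point is paid for once, with at most \<open>r\<close> letters, at the stage where
  \<open>rho\<close> is newly inserted into the orbit; later moves carry its lamp along.\<close>

lemma wr_ball_lower:
  assumes S: "S \<subseteq> carrier G"
    and f: "\<And>x. x \<in> orb w \<Longrightarrow> f x \<in> ball G S r" "\<And>x. x \<notin> orb w \<Longrightarrow> f x = \<one>"
  shows "WEl f (ev (rev w)) \<in> ball (Wr G) (wr_gens G S) (length w + r * card (orb w))"
  using f
proof (induction w arbitrary: f)
  interpret W: group "Wr G" by (rule group_Wr)
  {
    case Nil
    have c: "f rho \<in> carrier G" using Nil(1)[of rho] ball_subset_carrier[OF S] by auto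
    have "WEl (\<lambda>_. \<one>) (ev (rev [])) \<in> ball (Wr G) (wr_gens G S) 0"
      by (simp add: W.ball_0 Wr_one)
    from wr_ball_lamp[OF S this, of "f rho" r]
    have "WEl ((\<lambda>_. \<one>)(rho := f rho \<otimes> \<one>)) (ev (rev [])) \<in> ball (Wr G) (wr_gens G S) r"
      using Nil(1)[of rho] by simp
    moreover have "(\<lambda>_. \<one>)(rho := f rho \<otimes> \<one>) = f"
      by (rule ext) (use Nil(2) c in auto)
    moreover have "length ([] :: gen list) + r * card (orb []) = r" by simp
    ultimately show ?case by (simp only:)
  next
    case (Cons s w)
    \<comment> \<open>The configuration before the move by \<open>s\<close>. A value at a newly
      inserted \<open>rho\<close> is left out and added after the move.\<close>
    define f' where "f' = (\<lambda>y. if y \<in> orb w then f (gen_act s y) else \<one>)"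
    have ih: "WEl f' (ev (rev w)) \<in> ball (Wr G) (wr_gens G S) (length w + r * card (orb w))"
      by (rule Cons.IH) (use Cons.prems(1) in \<open>auto simp: f'_def\<close>)
    hence l: "f' \<in> lamps G"
      using W.ball_subset_carrier[OF wr_gens_subset[OF S]] WEl_in_carrier by blast
    have "mover G (gen_act s) \<in> wr_gens G S \<union> m_inv (Wr G) ` wr_gens G S"
      by (simp add: wr_gens_def)
    hence "mover G (gen_act s) \<otimes>\<^bsub>Wr G\<^esub> WEl f' (ev (rev w))
        \<in> ball (Wr G) (wr_gens G S) (Suc (length w + r * card (orb w)))"
      using ih unfolding W.ball_Suc by blast
    hence m: "WEl (\<lambda>x. f' (gen_act s x)) (ev (rev (s # w)))
        \<in> ball (Wr G) (wr_gens G S) (Suc (length w + r * card (orb w)))"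
      using mover_mult[OF l Grig_gen] by (simp add: ev_append comp_def)
    have mem: "gen_act s x \<in> orb w \<longleftrightarrow> x \<in> gen_act s ` orb w" for x
      using imageI[of "gen_act s x" "orb w" "gen_act s"] by auto
    have ci: "card (gen_act s ` orb w) = card (orb w)"
      by (intro card_image inj_on_subset[OF bij_is_inj[OF bij_gen_act]]) auto
    show ?case
    proof (cases "rho \<in> gen_act s ` orb w")
      case True
      hence o: "orb (s # w) = gen_act s ` orb w" by auto
      have "f' (gen_act s x) = f x" for x
        using Cons.prems(2)[of x] mem[of x] unfolding o by (auto simp: f'_def)
      thus ?thesis using m ci by (simp add: o del: orb.simps)
    next
      case False
      have o: "card (orb (s # w)) = Suc (card (orb w))" using False ci by simp
      have nr: "gen_act s rho \<notin> orb w" using False mem by blast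
      have c: "f rho \<in> ball G S r" "f rho \<in> carrier G"
        using Cons.prems(1)[of rho] ball_subset_carrier[OF S] by auto
      have "(\<lambda>x. f' (gen_act s x))(rho := f rho \<otimes> f' (gen_act s rho)) = f"
      proof
        fix x
        show "((\<lambda>x. f' (gen_act s x))(rho := f rho \<otimes> f' (gen_act s rho))) x = f x"
          using Cons.prems(2)[of x] mem[of x] nr c by (auto simp: f'_def)
      qed
      thus ?thesis using wr_ball_lamp[OF S m c(1)] by (simp add: o algebra_simps del: orb.simps)
    qed
  }
qed

lemma mover_generated: "mover G (ev u) \<in> generate (Wr G) (wr_gens G S)"
proof (induction u)
  case Nil
  show ?case using generate.one[of "Wr G" "wr_gens G S"] by (simp only: mover_def Wr_one ev_Nil)
next
  case (Cons s u)
  have s: "mover G (gen_act s) \<in> generate (Wr G) (wr_gens G S)"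
    by (rule generate.incl) (simp add: wr_gens_def)
  have "(\<lambda>x. if x \<in> Xorb then \<one> \<otimes> \<one> else \<one>) = (\<lambda>_. \<one>)"
    by (rule ext) simp
  thus ?case using generate.eng[OF Cons s]
    by (simp only: mover_def Wr_mult ev_Cons)
qed

lemma generate_Wr:
  assumes S: "S \<subseteq> carrier G" "generate G S = carrier G"
  shows "generate (Wr G) (wr_gens G S) = carrier (Wr G)"
proof
  interpret W: group "Wr G" by (rule group_Wr)
  show "generate (Wr G) (wr_gens G S) \<subseteq> carrier (Wr G)"
    using W.generate_incl wr_gens_subset S by blast
  show "carrier (Wr G) \<subseteq> generate (Wr G) (wr_gens G S)"
  proof
    fix z assume "z \<in> carrier (Wr G)"
    then obtain f g where z: "z = WEl f g" "f \<in> lamps G" "g \<in> Grig" by (rule carrier_Wr_cases)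
    let ?F = "{x. f x \<noteq> \<one>}"
    have F: "finite ?F" "?F \<subseteq> Xorb" using lamps_finite[OF z(2)] lamps_off[OF z(2)] by auto
    obtain w where w: "?F \<subseteq> orb w" using finite_orb_cover[OF F] by blast
    have "f ` ?F \<subseteq> generate G S" using lamps_closed[OF z(2)] S by auto
    then obtain r where r: "f ` ?F \<subseteq> ball G S r"
      using finite_subset_ball[OF S(1) finite_imageI[OF F(1)]] by blast
    have "WEl f (ev (rev w)) \<in> ball (Wr G) (wr_gens G S) (length w + r * card (orb w))"
    proof (rule wr_ball_lower[OF S(1)])
      fix x
      show "f x \<in> ball G S r" using r one_in_ball[of S r] by (cases "f x = \<one>") auto
      assume "x \<notin> orb w"
      thus "f x = \<one>" using w by auto
    qed
    hence a: "WEl f (ev (rev w)) \<in> generate (Wr G) (wr_gens G S)"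
      using W.ball_subset_generate by blast
    obtain v where v: "g = ev v" using z(3) by (auto simp: Grig_eq)
    \<comment> \<open>The word that sets the lamps forces the component \<open>ev (rev w)\<close>;
      the mover undoes it and supplies \<open>g\<close>.\<close>
    have "WEl f (ev (rev w)) \<otimes>\<^bsub>Wr G\<^esub> mover G (ev (v @ w)) = WEl f g"
    proof -
      have "ev (v @ w) \<circ> ev (rev w) = g"
        by (rule ext) (simp add: v ev_append ev_ev_rev)
      thus ?thesis using lamps_closed[OF z(2)] lamps_off[OF z(2)]
        by (auto simp: mover_def Wr_mult fun_eq_iff)
    qed
    thus "z \<in> generate (Wr G) (wr_gens G S)"
      using generate.eng[OF a mover_generated[of "v @ w" S]] z(1) by simp
  qed
qed

section \<open>Ball sizes in terms of inverted orbits\<close>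

lemma card_wr_ball_lower:
  assumes S: "finite S" "S \<subseteq> carrier G"
  shows "card (ball G S r) ^ card (orb w)
      \<le> card (ball (Wr G) (wr_gens G S) (length w + r * card (orb w)))"
proof -
  interpret W: group "Wr G" by (rule group_Wr)
  let ?P = "\<Pi>\<^sub>E x\<in>orb w. ball G S r"
  let ?h = "\<lambda>f. WEl (\<lambda>x. if x \<in> orb w then f x else \<one>) (ev (rev w))"
  have "inj_on ?h ?P"
  proof (rule inj_onI)
    fix f f' assume f: "f \<in> ?P" "f' \<in> ?P" "?h f = ?h f'"
    show "f = f'"
    proof (rule PiE_ext[OF f(1,2)])
      fix x assume "x \<in> orb w"
      thus "f x = f' x" using f(3) by (auto dest!: fun_cong[of _ _ x])
    qed
  qed
  hence "card ?P = card (?h ` ?P)" by (simp add: card_image)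
  also have "\<dots> \<le> card (ball (Wr G) (wr_gens G S) (length w + r * card (orb w)))"
  proof (rule card_mono)
    show "finite (ball (Wr G) (wr_gens G S) (length w + r * card (orb w)))"
      by (intro W.finite_ball finite_wr_gens S)
    show "?h ` ?P \<subseteq> ball (Wr G) (wr_gens G S) (length w + r * card (orb w))"
      by (rule image_subsetI, rule wr_ball_lower[OF S(2)]) (auto simp: PiE_def Pi_def)
  qed
  finally show ?thesis by (simp add: card_PiE)
qed

text \<open>An element is encoded by a portrait with its point set \<open>Y\<close>, a distribution
  \<open>r\<close> of the lamp length over \<open>Y\<close>, and lamp values within these radii; the
  three factors bound the respective numbers of choices. \<open>E\<close> is uniform in
  \<open>Y\<close> and \<open>r\<close>, which leaves the optimisation over distributions to the
  growth estimate.\<close>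

lemma card_wr_ball_upper:
  fixes E :: real
  assumes S: "finite S" "S \<subseteq> carrier G"
    and N: "1 \<le> N" "((real n + B0) / B0) powr alpha < real N + 1"
    and E: "\<And>Y r. finite Y \<Longrightarrow> card Y \<le> N \<Longrightarrow> sum r Y \<le> n \<Longrightarrow>
      (\<Prod>x\<in>Y. real (card (ball G S (r (x :: seq))))) \<le> E"
  shows "real (card (ball (Wr G) (wr_gens G S) n)) \<le> real ((32 * N) ^ (2 * N - 1)) * (real (n + 1) ^ N * E)"
proof -
  have E0: "1 \<le> E" using E[of "{}" "\<lambda>_. 0"] by simp
  define R where "R = (\<lambda>Y :: seq set. {r \<in> Y \<rightarrow>\<^sub>E {0..n}. sum r Y \<le> n})"
  \<comment> \<open>The portrait describes \<open>ev w\<close>, whereas the group component of the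
    element is \<open>ev (rev w)\<close>, its inverse.\<close>
  define Z where "Z = (\<lambda>g Y r. (\<lambda>f. WEl (\<lambda>x. if x \<in> Y then f x else \<one>) (inv_into UNIV g)) `
      (\<Pi>\<^sub>E x\<in>Y. ball G S (r x)))"
  have finP: "finite (\<Pi>\<^sub>E x\<in>Y. ball G S (r x))" if "finite Y" for Y :: "seq set" and r
    using that by (intro finite_PiE finite_ball S)
  have finR: "finite (R Y)" "card (R Y) \<le> (n + 1) ^ card Y" if "finite Y" for Y
  proof -
    have f: "finite (Y \<rightarrow>\<^sub>E {0..n})" using that by (intro finite_PiE) auto
    thus "finite (R Y)" by (simp add: R_def)
    have "card (R Y) \<le> card (Y \<rightarrow>\<^sub>E {0..n})" by (intro card_mono f) (auto simp: R_def)
    thus "card (R Y) \<le> (n + 1) ^ card Y" using that by (simp add: card_PiE)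
  qed
  have finZ: "finite (Z g Y r)" "card (Z g Y r) \<le> (\<Prod>x\<in>Y. card (ball G S (r x)))"
    if "finite Y" for g Y r
  proof -
    show "finite (Z g Y r)" unfolding Z_def by (intro finite_imageI finP that)
    have "card (Z g Y r) \<le> card (\<Pi>\<^sub>E x\<in>Y. ball G S (r x))"
      unfolding Z_def by (intro card_image_le finP that)
    thus "card (Z g Y r) \<le> (\<Prod>x\<in>Y. card (ball G S (r x)))" using that by (simp add: card_PiE)
  qed
  have finY: "finite Y \<and> card Y \<le> N" if "(g, Y) \<in> ports N" for g Y
    using port_finite that by (auto simp: ports_def)
  have finports: "finite (ports N)" using ports_card by blast
  have sub: "ball (Wr G) (wr_gens G S) n \<subseteq> (\<Union>(g, Y)\<in>ports N. \<Union>r\<in>R Y. Z g Y r)"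
  proof
    fix z assume z: "z \<in> ball (Wr G) (wr_gens G S) n"
    obtain w f r where w: "z = WEl f (ev (rev w))" "length w \<le> n" "\<And>x. f x \<in> ball G S (r x)"
        "\<And>x. x \<notin> orb w \<Longrightarrow> r x = 0" "sum r (orb w) \<le> n"
      using wr_ball_shape[OF S(2) z] by blast
    obtain m Y where m: "port m (ev w) Y" "orb w \<subseteq> Y" "real m \<le> ((nrm w + B0) / B0) powr alpha"
      using port_exists by blast
    have "(nrm w + B0) / B0 \<le> (real n + B0) / B0"
      using nrm_le_length[of w] w(2) B0_pos by (intro divide_right_mono) simp_all
    moreover have "0 \<le> (nrm w + B0) / B0" using nrm_nonneg[of w] B0_pos by simp
    ultimately have "((nrm w + B0) / B0) powr alpha \<le> ((real n + B0) / B0) powr alpha"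
      using alpha_bounds by (intro powr_mono2) simp_all
    hence "real m < real N + 1" by (rule le_less_trans[OF order_trans[OF m(3)] N(2)])
    hence "m \<le> N" by linarith
    hence "port N (ev w) Y" using port_mono[OF m(1)] by blast
    hence p: "(ev w, Y) \<in> ports N" by (simp only: ports_def mem_Collect_eq prod.case)
    have fY: "finite Y" using finY p by blast
    define r' where "r' = restrict r Y"
    have "sum r' Y = sum r Y" by (simp add: r'_def)
    also have "\<dots> = sum r (orb w)"
      using m(2) fY w(4) by (intro sum.mono_neutral_right) auto
    finally have s: "sum r' Y \<le> n" using w(5) by simp
    have "r' x \<le> n" if "x \<in> Y" for x
      using member_le_sum[of x Y r'] that fY s by auto
    hence r': "r' \<in> R Y" using s by (simp add: R_def PiE_def Pi_def) (simp add: r'_def)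
    have "(\<lambda>x. if x \<in> Y then restrict f Y x else \<one>) = f"
    proof
      fix x
      show "(if x \<in> Y then restrict f Y x else \<one>) = f x"
      proof (cases "x \<in> Y")
        case False
        hence "r x = 0" using w(4) m(2) by blast
        thus ?thesis using False w(3)[of x] by (simp add: ball_0)
      qed simp
    qed
    moreover have "restrict f Y \<in> (\<Pi>\<^sub>E x\<in>Y. ball G S (r' x))"
      using w(3) by (auto simp: r'_def)
    ultimately have "z \<in> Z (ev w) Y r'"
      unfolding Z_def w(1) inv_ev by (intro image_eqI[of _ _ "restrict f Y"]) (simp_all only:)
    hence "z \<in> (\<Union>r\<in>R Y. Z (ev w) Y r)" using r' by (rule UN_I[rotated])
    thus "z \<in> (\<Union>(g, Y)\<in>ports N. \<Union>r\<in>R Y. Z g Y r)"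
      by (intro UN_I[OF p]) (simp only: prod.case)
  qed
  have fin: "finite (\<Union>(g, Y)\<in>ports N. \<Union>r\<in>R Y. Z g Y r)"
  proof (rule finite_UN_I[OF finports])
    fix p assume "p \<in> ports N"
    then obtain g Y where p: "p = (g, Y)" "(g, Y) \<in> ports N" by (cases p) auto
    have Y: "finite Y" using finY[OF p(2)] by blast
    show "finite (case p of (g, Y) \<Rightarrow> \<Union>r\<in>R Y. Z g Y r)"
      unfolding p(1) prod.case by (intro finite_UN_I finR(1) finZ(1) Y)
  qed
  have "real (card (ball (Wr G) (wr_gens G S) n)) \<le> real (card (\<Union>(g, Y)\<in>ports N. \<Union>r\<in>R Y. Z g Y r))"
    using card_mono[OF fin sub] by simp
  also have "\<dots> \<le> real (card (ports N)) * (real (n + 1) ^ N * E)"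
  proof (rule card_UN_le_mult[OF finports])
    fix p assume "p \<in> ports N"
    then obtain g Y where p: "p = (g, Y)" "(g, Y) \<in> ports N" by (cases p) auto
    have Y: "finite Y" "card Y \<le> N" using finY[OF p(2)] by auto
    have "real (card (\<Union>r\<in>R Y. Z g Y r)) \<le> real (card (R Y)) * E"
    proof (rule card_UN_le_mult[OF finR(1)[OF Y(1)]])
      fix r assume r: "r \<in> R Y"
      have "real (card (Z g Y r)) \<le> real (\<Prod>x\<in>Y. card (ball G S (r x)))"
        using finZ(2)[OF Y(1)] by (simp only: of_nat_le_iff)
      also have "\<dots> \<le> E" using E[OF Y, of r] r by (simp add: R_def)
      finally show "real (card (Z g Y r)) \<le> E" .
    qed
    also have "\<dots> \<le> real (n + 1) ^ N * E"
    proof (rule mult_right_mono)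
      have "card (R Y) \<le> (n + 1) ^ N"
        using finR(2)[OF Y(1)] power_increasing[OF Y(2), of "n + 1"] by simp
      thus "real (card (R Y)) \<le> real (n + 1) ^ N" by (metis of_nat_le_iff of_nat_power)
    qed (use E0 in simp)
    finally show "real (card (case p of (g, Y) \<Rightarrow> \<Union>r\<in>R Y. Z g Y r)) \<le> real (n + 1) ^ N * E"
      using p by simp
  qed
  also have "\<dots> \<le> real ((32 * N) ^ (2 * N - 1)) * (real (n + 1) ^ N * E)"
  proof (rule mult_right_mono)
    show "real (card (ports N)) \<le> real ((32 * N) ^ (2 * N - 1))"
      using ports_card[of N] N(1) by (simp only: of_nat_le_iff)
  qed (use E0 in simp)
  finally show ?thesis .
qed

end

section \<open>Growth of wreath products\<close>

text \<open>Demanded for all n, since a lamp may receive any radius; log (n + 1) keeps the bound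
  meaningful at radius 1, where log n vanishes. The lower counterpart is only eventual, as there all
  lamps share one large radius.\<close>

definition upper_growth :: "('a, 'b) monoid_scheme \<Rightarrow> 'a set \<Rightarrow> real \<Rightarrow> bool" where
  "upper_growth G S b \<longleftrightarrow> (\<exists>C>0. \<forall>n. real (card (ball G S n)) \<le> exp (C * ln (real n + 1) * real n powr b))"

definition lower_growth :: "('a, 'b) monoid_scheme \<Rightarrow> 'a set \<Rightarrow> real \<Rightarrow> bool" where
  "lower_growth G S b \<longleftrightarrow>
     (\<exists>c>0. \<exists>N. \<forall>n\<ge>N. exp (c * ln (real n) * real n powr b) \<le> real (card (ball G S n)))"

text \<open>A linear majorant of a concave power with a free threshold t: the first term covers x
  \<le> t, the second covers larger x.\<close>

lemma powr_le_split:
  fixes t b x :: real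
  assumes "0 < t" "0 \<le> b" "b \<le> 1" "0 \<le> x"
  shows "x powr b \<le> t powr b + t powr (b - 1) * x"
proof (cases "x \<le> t")
  case True
  have "x powr b \<le> t powr b" using True assms by (intro powr_mono2) auto
  thus ?thesis using assms by (simp add: add_increasing2)
next
  case False
  have "x powr b = x powr (b - 1) * x" using False assms by (simp add: powr_mult_base[symmetric] powr_diff)
  also have "\<dots> \<le> t powr (b - 1) * x"
    using False assms by (intro mult_right_mono powr_mono2') auto
  finally show ?thesis using assms by (simp add: add_increasing)
qed

text \<open>Concavity up to a factor 2: an even distribution is the worst case, and the threshold t
  = n / M is the even share.\<close>

lemma sum_powr_le:
  fixes M b :: real and r :: "'a \<Rightarrow> nat"
  assumes "finite Y" "real (card Y) \<le> M" "sum r Y \<le> n" "0 < M" "1 \<le> n" "0 \<le> b" "b \<le> 1"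
  shows "(\<Sum>x\<in>Y. real (r x) powr b) \<le> 2 * (M powr (1 - b) * real n powr b)"
proof -
  define t where "t = real n / M"
  have t: "0 < t" using assms by (simp add: t_def)
  have "(\<Sum>x\<in>Y. real (r x) powr b) \<le> (\<Sum>x\<in>Y. t powr b + t powr (b - 1) * real (r x))"
    using assms t by (intro sum_mono powr_le_split) auto
  also have "\<dots> = real (card Y) * t powr b + t powr (b - 1) * real (sum r Y)"
    by (simp add: sum.distrib sum_distrib_left)
  also have "\<dots> \<le> M * t powr b + t powr (b - 1) * real n"
    using assms(2,3) by (intro add_mono mult_right_mono mult_left_mono) (simp_all del: of_nat_sum)
  also have "M * t powr b = M powr (1 - b) * real n powr b"
    using assms by (simp add: t_def powr_divide powr_diff)
  also have "t powr (b - 1) * real n = M powr (1 - b) * real n powr b"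
    using assms by (simp add: t_def powr_divide powr_diff)
  finally show ?thesis by (simp only: mult_2)
qed

lemma power_eq_exp: "0 < x \<Longrightarrow> (x::real) ^ n = exp (real n * ln x)"
  by (simp add: exp_of_nat_mult)

context lamp_group
begin

lemma upper_growth_Wr:
  assumes S: "finite S" "S \<subseteq> carrier G" and b: "0 \<le> b" "b < 1" and u: "upper_growth G S b"
  shows "upper_growth (Wr G) (wr_gens G S) (alpha + (1 - alpha) * b)"
proof -
  interpret W: group "Wr G" by (rule group_Wr)
  obtain C where C: "0 < C" "\<And>n. real (card (ball G S n)) \<le> exp (C * ln (real n + 1) * real n powr b)"
    using u unfolding upper_growth_def by blast
  define K where "K = ((1 + B0) / B0) powr alpha"
  have K: "1 \<le> K" unfolding K_def using B0_pos alpha_bounds by (intro ge_one_powr_ge_zero) auto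
  \<comment> \<open>Chosen so that ln (32 N) \<le> ln (32 K n) \<le> D ln (n + 1); the constant ln
    (32 K) is absorbed by ln 2 \<le> ln (n + 1).\<close>
  define D where "D = ln (32 * K) / ln 2 + 1"
  have D: "1 \<le> D" using K by (simp add: D_def)
  define C' where "C' = (2 * D + 1) * K + 2 * C * K powr (1 - b)"
  have C': "0 < C'" using C K D by (auto simp: C'_def intro!: add_pos_pos mult_pos_pos)
  have "real (card (ball (Wr G) (wr_gens G S) n))
      \<le> exp (C' * ln (real n + 1) * real n powr (alpha + (1 - alpha) * b))" for n
  proof (cases "n = 0")
    case False
    hence n: "1 \<le> n" "1 \<le> real n" by auto
    define l where "l = ln (real n + 1)"
    have l: "ln 2 \<le> l" "0 < l" using n by (auto simp: l_def)
    define M where "M = K * real n powr alpha"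
    have n1: "1 \<le> real n powr alpha" using n alpha_bounds by (intro ge_one_powr_ge_zero) auto
    have M: "1 \<le> M" unfolding M_def using mult_mono[OF K n1] K by simp
    define N where "N = nat \<lfloor>((real n + B0) / B0) powr alpha\<rfloor>"
    have x1: "1 \<le> ((real n + B0) / B0) powr alpha"
      using B0_pos alpha_bounds by (intro ge_one_powr_ge_zero) auto
    have N1: "1 \<le> N" using x1 unfolding N_def by linarith
    have Nlt: "((real n + B0) / B0) powr alpha < real N + 1" using x1 unfolding N_def by linarith
    have "((real n + B0) / B0) powr alpha \<le> ((1 + B0) / B0 * real n) powr alpha"
    proof (rule powr_mono2)
      have "real n + B0 \<le> (1 + B0) * real n"
        using n B0_pos mult_left_mono[of 1 "real n" B0] by (simp add: distrib_right)
      thus "(real n + B0) / B0 \<le> (1 + B0) / B0 * real n" using B0_pos by (simp add: field_simps)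
    qed (use B0_pos alpha_bounds in auto)
    also have "\<dots> = M" unfolding M_def K_def by (rule powr_mult)
    finally have NM: "real N \<le> M" using x1 unfolding N_def by linarith
    define E where "E = exp (C * l * (2 * (M powr (1 - b) * real n powr b)))"
    have "real (card (ball (Wr G) (wr_gens G S) n))
        \<le> real ((32 * N) ^ (2 * N - 1)) * (real (n + 1) ^ N * E)"
    proof (rule card_wr_ball_upper[OF S N1 Nlt])
      fix Y :: "seq set" and r :: "seq \<Rightarrow> nat"
      assume Y: "finite Y" "card Y \<le> N" "sum r Y \<le> n"
      have rn: "r x \<le> n" if "x \<in> Y" for x
        using member_le_sum[OF that, of r] Y by simp
      have "(\<Prod>x\<in>Y. real (card (ball G S (r x)))) \<le> (\<Prod>x\<in>Y. exp (C * l * real (r x) powr b))"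
      proof (rule prod_mono, safe)
        fix x assume x: "x \<in> Y"
        have "real (card (ball G S (r x))) \<le> exp (C * ln (real (r x) + 1) * real (r x) powr b)"
          by (rule C)
        also have "\<dots> \<le> exp (C * l * real (r x) powr b)"
          using C(1) rn[OF x] unfolding l_def by (simp add: mult_left_mono mult_right_mono)
        finally show "real (card (ball G S (r x))) \<le> exp (C * l * real (r x) powr b)" .
      qed simp
      also have "\<dots> = exp (C * l * (\<Sum>x\<in>Y. real (r x) powr b))"
        by (simp add: exp_sum[OF Y(1)] sum_distrib_left)
      also have "\<dots> \<le> E"
      proof -
        have "(\<Sum>x\<in>Y. real (r x) powr b) \<le> 2 * (M powr (1 - b) * real n powr b)"
          using Y M NM n b by (intro sum_powr_le) auto
        thus ?thesis unfolding E_def using C(1) l by (simp add: mult_left_mono)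
      qed
      finally show "(\<Prod>x\<in>Y. real (card (ball G S (r x)))) \<le> E" .
    qed
    also have "real ((32 * N) ^ (2 * N - 1)) \<le> exp (2 * M * (D * l))"
    proof -
      have "real ((32 * N) ^ (2 * N - 1)) \<le> real (32 * N) ^ (2 * N)"
        using N1 power_increasing[of "2 * N - 1" "2 * N" "real (32 * N)"] by simp
      also have "\<dots> = exp (real (2 * N) * ln (real (32 * N)))"
        using N1 by (intro power_eq_exp) simp
      also have "\<dots> \<le> exp (2 * M * (D * l))"
      proof -
        have "real (32 * N) \<le> 32 * K * real n"
        proof -
          have "real n powr alpha \<le> real n powr 1" using n alpha_bounds by (intro powr_mono) auto
          hence "M \<le> K * real n" unfolding M_def using K n by (intro mult_left_mono) auto
          thus ?thesis using NM by simp
        qed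
        hence "ln (real (32 * N)) \<le> ln (32 * K * real n)"
          using N1 K n by (subst ln_le_cancel_iff) auto
        also have "\<dots> = ln (32 * K) + ln (real n)" using K n by (simp add: ln_mult)
        also have "\<dots> \<le> ln (32 * K) / ln 2 * l + l"
        proof (rule add_mono)
          have "ln (32 * K) = ln (32 * K) / ln 2 * ln 2" by simp
          also have "\<dots> \<le> ln (32 * K) / ln 2 * l" using l K by (intro mult_left_mono) auto
          finally show "ln (32 * K) \<le> ln (32 * K) / ln 2 * l" .
          show "ln (real n) \<le> l" using n by (simp add: l_def)
        qed
        also have "\<dots> = D * l" by (simp add: D_def distrib_right)
        finally have "ln (real (32 * N)) \<le> D * l" .
        moreover have "real (2 * N) \<le> 2 * M" using NM by simp
        moreover have "0 \<le> ln (real (32 * N))" using N1 by (intro ln_ge_zero) simp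
        ultimately have "real (2 * N) * ln (real (32 * N)) \<le> 2 * M * (D * l)"
          using M by (intro mult_mono) simp_all
        thus ?thesis by simp
      qed
      finally show ?thesis .
    qed
    also have "real (n + 1) ^ N \<le> exp (M * l)"
    proof -
      have "real (n + 1) ^ N = exp (real N * l)"
        by (subst power_eq_exp) (simp_all add: l_def add.commute)
      also have "\<dots> \<le> exp (M * l)" using NM l by (simp add: mult_right_mono)
      finally show ?thesis .
    qed
    finally have "real (card (ball (Wr G) (wr_gens G S) n)) \<le> exp (2 * M * (D * l)) * (exp (M * l) * E)"
      by (simp add: E_def)
    also have "\<dots> = exp (l * ((2 * D + 1) * M + 2 * C * (M powr (1 - b) * real n powr b)))"
      unfolding E_def by (simp add: exp_add[symmetric] algebra_simps)
    also have "\<dots> \<le> exp (l * (C' * real n powr (alpha + (1 - alpha) * b)))"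
    proof -
      have "(2 * D + 1) * M \<le> (2 * D + 1) * (K * real n powr (alpha + (1 - alpha) * b))"
        unfolding M_def using K D n alpha_bounds b by (intro mult_left_mono powr_mono) auto
      \<comment> \<open>The source of the new exponent: \<alpha> (1 - b) + b = \<alpha> + (1 -
        \<alpha>) b.\<close>
      moreover have "M powr (1 - b) * real n powr b = K powr (1 - b) * real n powr (alpha + (1 - alpha) * b)"
        using K n by (simp add: M_def powr_mult powr_powr powr_add[symmetric] algebra_simps)
      ultimately have "(2 * D + 1) * M + 2 * C * (M powr (1 - b) * real n powr b)
          \<le> C' * real n powr (alpha + (1 - alpha) * b)"
        by (simp add: C'_def algebra_simps)
      thus ?thesis using l by (simp add: mult_left_mono)
    qed
    finally show ?thesis by (simp add: l_def mult_ac)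
  qed (simp add: W.ball_0)
  thus ?thesis using C' unfolding upper_growth_def by blast
qed

text \<open>At level j there is a word of length of order (2 / \<eta>)^j with at least 2^j lamps.
  Each lamp can receive a radius of order (1 / \<eta>)^j, which is the power 1 - \<alpha> of (2 /
  \<eta>)^j, at a total cost comparable to the length.\<close>

lemma lower_growth_Wr:
  assumes S: "finite S" "S \<subseteq> carrier G" and b: "0 \<le> b" "b < 1" and u: "lower_growth G S b"
  shows "lower_growth (Wr G) (wr_gens G S) (alpha + (1 - alpha) * b)"
proof -
  interpret W: group "Wr G" by (rule group_Wr)
  obtain c N0 where c: "0 < c"
    "\<And>n. n \<ge> N0 \<Longrightarrow> exp (c * ln (real n) * real n powr b) \<le> real (card (ball G S n))"
    using u unfolding lower_growth_def by blast
  define la where "la = 2 / eta"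
  have la: "2 < la" using eta_pos eta_lt_1 by (simp add: la_def field_simps)
  have la_alpha: "la powr alpha = 2" unfolding la_def by (rule two_div_eta_powr_alpha)
  obtain C1 where C1: "0 < C1" "\<And>j. \<exists>w. real (length w) \<le> C1 * la ^ j \<and> 2 ^ j \<le> card (orb w)"
    using long_orbits unfolding la_def by blast
  define K2 where "K2 = ((C1 + B0) / B0) powr alpha"
  have la1: "1 \<le> la ^ j" for j using la by (intro one_le_power) simp
  have la_pow: "(la ^ j) powr alpha = 2 ^ j" for j
  proof -
    have "(la ^ j) powr alpha = (la powr real j) powr alpha" using la by (simp add: powr_realpow)
    also have "\<dots> = (la powr alpha) powr real j" by (rule powr_powr_swap)
    finally show ?thesis by (simp add: la_alpha powr_realpow)
  qed
  have la_pow': "(la ^ j) powr (1 - alpha) = (la / 2) ^ j" for j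
    using la by (simp add: powr_diff la_pow power_divide)
  \<comment> \<open>\<open>C1\<close> accounts for the word itself, \<open>K2\<close> for the lamps
    along its orbit.\<close>
  define Q where "Q = C1 + K2"
  have K2: "0 < K2" unfolding K2_def using C1(1) B0_pos by (simp add: divide_pos_pos)
  have Q: "0 < Q" using C1(1) K2 by (simp add: Q_def)
  have step: "real (card (ball G S r)) ^ (2 ^ j) \<le> real (card (ball (Wr G) (wr_gens G S) n))"
    if r: "real r \<le> (la / 2) ^ j" and n: "Q * la ^ j \<le> real n" for r j n
  proof -
    obtain w where w: "real (length w) \<le> C1 * la ^ j" "2 ^ j \<le> card (orb w)" using C1(2) by blast
    obtain m Y where m: "port m (ev w) Y" "orb w \<subseteq> Y" "real m \<le> ((nrm w + B0) / B0) powr alpha"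
      using port_exists by blast
    have "real (card (orb w)) \<le> real m"
      using card_mono[OF _ m(2)] port_finite[OF m(1)] by simp
    also have "\<dots> \<le> ((nrm w + B0) / B0) powr alpha" by (rule m(3))
    also have "\<dots> \<le> ((C1 + B0) / B0 * la ^ j) powr alpha"
    proof (rule powr_mono2)
      have "nrm w + B0 \<le> C1 * la ^ j + B0 * la ^ j"
        using nrm_le_length[of w] w(1) la1[of j] B0_pos by (intro add_mono) auto
      hence "(nrm w + B0) / B0 \<le> (C1 * la ^ j + B0 * la ^ j) / B0"
        using B0_pos by (intro divide_right_mono) simp_all
      thus "(nrm w + B0) / B0 \<le> (C1 + B0) / B0 * la ^ j" by (simp add: distrib_right)
    qed (use nrm_nonneg[of w] B0_pos alpha_bounds in simp_all)
    also have "\<dots> = K2 * 2 ^ j"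
      unfolding K2_def la_pow[symmetric] by (rule powr_mult)
    finally have o: "real (card (orb w)) \<le> K2 * 2 ^ j" .
    have "real r * real (card (orb w)) \<le> (la / 2) ^ j * (K2 * 2 ^ j)"
      using r o la by (intro mult_mono) auto
    also have "\<dots> = K2 * la ^ j" by (simp add: power_divide)
    finally have "real (length w + r * card (orb w)) \<le> Q * la ^ j"
      using w(1) by (simp add: Q_def distrib_right)
    hence len: "length w + r * card (orb w) \<le> n" using n by linarith
    have "card (ball G S r) ^ (2 ^ j) \<le> card (ball G S r) ^ card (orb w)"
      using w(2) card_ball_pos[OF S(1)] by (intro power_increasing) simp_all
    also have "\<dots> \<le> card (ball (Wr G) (wr_gens G S) (length w + r * card (orb w)))"
      by (rule card_wr_ball_lower[OF S])
    also have "\<dots> \<le> card (ball (Wr G) (wr_gens G S) n)"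
      by (intro card_mono W.finite_ball finite_wr_gens S W.ball_mono len)
    finally show ?thesis by (simp flip: of_nat_power)
  qed
  define q where "q = 1 / (Q * la)"
  have q: "0 < q" using Q la by (simp add: q_def)
  \<comment> \<open>Half of the exponent 1 - \<alpha>: for large n the other half absorbs the
    constant \<open>h\<close>, so that r \<ge> n^e and ln r \<ge> e ln n.\<close>
  define e where "e = (1 - alpha) / 2"
  have e: "0 < e" using alpha_bounds by (simp add: e_def)
  \<comment> \<open>The factor 1 / 2 pays for rounding down in \<open>r\<close>: a real number that
    is at least 2 x with x \<ge> 1 has integer part at least x.\<close>
  define h where "h = q powr (1 - alpha) / 2"
  have h: "0 < h" using q by (simp add: h_def)
  define Z where "Z = max 1 (max (1 / h) (max (real N0) 1))"
  define c' where "c' = q powr alpha * (c * e) * h powr b"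
  have c': "0 < c'" using q c(1) e h by (simp add: c'_def)
  have "exp (c' * ln (real n) * real n powr (alpha + (1 - alpha) * b))
      \<le> real (card (ball (Wr G) (wr_gens G S) n))"
    if n: "n \<ge> nat \<lceil>max (Z powr (1 / e)) (max Q 1)\<rceil>" for n
  proof -
    have nZ: "Z powr (1 / e) \<le> real n" and nQ: "Q \<le> real n" and n1: "1 \<le> real n"
      using n by linarith+
    have "Z = (Z powr (1 / e)) powr e" using e by (simp add: powr_powr Z_def)
    also have "\<dots> \<le> real n powr e" using nZ e by (intro powr_mono2) auto
    finally have Zn: "Z \<le> real n powr e" .
    \<comment> \<open>The largest level that fits into length n. The next level does not fit, which
      bounds \<open>la ^ j\<close> below by \<open>q * real n\<close>.\<close>
    define j where "j = nat \<lfloor>log la (real n / Q)\<rfloor>"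
    have lg: "0 \<le> log la (real n / Q)" using nQ Q la by (intro zero_le_log_cancel_iff[THEN iffD2]) simp_all
    have "real j \<le> log la (real n / Q)" using lg unfolding j_def by linarith
    hence "la powr real j \<le> real n / Q" using la Q n1 by (subst (asm) le_log_iff) simp_all
    hence j1: "Q * la ^ j \<le> real n" using Q la by (simp add: powr_realpow field_simps)
    have "log la (real n / Q) < real (j + 1)" using lg unfolding j_def by linarith
    hence "real n / Q < la powr real (j + 1)" using la Q n1 by (subst (asm) log_less_iff) simp_all
    hence "real n / Q < la ^ (j + 1)" using la by (subst (asm) powr_realpow) simp_all
    hence y: "q * real n \<le> la ^ j" using Q la by (simp add: q_def field_simps)
    define x where "x = h * real n powr (1 - alpha)"
    have x2: "2 * x \<le> (la / 2) ^ j"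
    proof -
      have "2 * x = (q * real n) powr (1 - alpha)" using q n1 by (simp add: x_def h_def powr_mult)
      also have "\<dots> \<le> (la ^ j) powr (1 - alpha)" using y q n1 alpha_bounds by (intro powr_mono2) auto
      finally show ?thesis by (simp add: la_pow')
    qed
    have xe: "real n powr e \<le> x"
    proof -
      have "real n powr (1 - alpha) = real n powr e * real n powr e"
        by (simp add: powr_add[symmetric] e_def)
      moreover have "1 \<le> h * real n powr e"
      proof -
        have "1 / h \<le> real n powr e" using Zn by (simp add: Z_def)
        thus ?thesis using h by (simp add: field_simps)
      qed
      ultimately show ?thesis unfolding x_def
        using mult_right_mono[of 1 "h * real n powr e" "real n powr e"] by (simp add: mult_ac)
    qed
    have x1: "1 \<le> x" "real N0 \<le> x" using xe Zn by (auto simp: Z_def)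
    define r where "r = nat \<lfloor>(la / 2) ^ j\<rfloor>"
    have r: "real r \<le> (la / 2) ^ j" using la by (simp add: r_def)
    have rx: "x \<le> real r" using x2 x1 unfolding r_def by linarith
    have rN: "N0 \<le> r" using rx x1(2) by linarith
    have "c' * ln (real n) * real n powr (alpha + (1 - alpha) * b)
        = (q * real n) powr alpha * (c * (e * ln (real n)) * x powr b)"
      using q n1 h by (simp add: c'_def x_def powr_mult powr_powr powr_add)
    also have "\<dots> \<le> (la ^ j) powr alpha * (c * ln (real r) * real r powr b)"
    proof (intro mult_mono powr_mono2)
      have "e * ln (real n) = ln (real n powr e)" using n1 by (simp add: ln_powr)
      also have "\<dots> \<le> ln (real r)"
      proof (subst ln_le_cancel_iff)
        show "0 < real r" using rx x1(1) by linarith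
      qed (use xe rx n1 in auto)
      finally show "e * ln (real n) \<le> ln (real r)" .
      show "0 \<le> c * ln (real r)" using c(1) rx x1 by simp
    qed (use y q n1 alpha_bounds c e rx x1 b in auto)
    also have "\<dots> = 2 ^ j * (c * ln (real r) * real r powr b)" by (simp add: la_pow)
    finally have "exp (c' * ln (real n) * real n powr (alpha + (1 - alpha) * b))
        \<le> exp (c * ln (real r) * real r powr b) ^ (2 ^ j)"
      by (simp flip: exp_of_nat_mult)
    also have "\<dots> \<le> real (card (ball G S r)) ^ (2 ^ j)"
      using c(2)[OF rN] by (intro power_mono) auto
    also have "\<dots> \<le> real (card (ball (Wr G) (wr_gens G S) n))"
      by (rule step[OF r j1])
    finally show ?thesis .
  qed
  thus ?thesis using c' unfolding lower_growth_def by blast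
qed

end

section \<open>The groups \<open>L\<^sub>k\<close>\<close>

lemma L_0_mult: "ZEl x \<otimes>\<^bsub>L 0\<^esub> ZEl y = ZEl (x + y)"
  by simp

lemma L_0_one: "\<one>\<^bsub>L 0\<^esub> = ZEl 0"
  by simp

lemma L_0_carrier: "carrier (L 0) = range ZEl"
  by simp

lemma group_L_0: "group (L 0)"
proof (rule groupI)
  fix x assume "x \<in> carrier (L 0)"
  then obtain m where "x = ZEl m" by auto
  thus "\<exists>y\<in>carrier (L 0). y \<otimes>\<^bsub>L 0\<^esub> x = \<one>\<^bsub>L 0\<^esub>"
    by (intro bexI[of _ "ZEl (- m)"]) auto
qed auto

lemma group_L: "group (L k)"
proof (induction k)
  case (Suc k)
  interpret lamp_group "L k" by (rule lamp_group.intro[OF Suc])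
  show ?case unfolding L_Suc by (rule group_Wr)
qed (rule group_L_0)

lemma inv_L_0: "m_inv (L 0) (ZEl x) = ZEl (- x)"
proof -
  interpret group "L 0" by (rule group_L_0)
  show ?thesis by (rule inv_equality) (simp_all add: L_0_mult L_0_one L_0_carrier del: L.simps)
qed

lemma ball_L_0: "ball (L 0) {ZEl 1} n = ZEl ` {- int n..int n}"
proof (induction n)
  interpret group "L 0" by (rule group_L_0)
  {
    case 0
    show ?case by (simp add: ball_0 L_0_one del: L.simps)
  next
    case (Suc n)
    have "ball (L 0) {ZEl 1} (Suc n) =
        insert (ZEl 0) ((\<lambda>x. ZEl (1 + x)) ` {- int n..int n} \<union> (\<lambda>x. ZEl (- 1 + x)) ` {- int n..int n})"
    proof -
      have i: "m_inv (L 0) ` {ZEl 1} = {ZEl (- 1)}" by (simp only: image_insert image_empty inv_L_0)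
      have "{s \<otimes>\<^bsub>L 0\<^esub> x | s x. s \<in> {ZEl 1} \<union> {ZEl (- 1)} \<and> x \<in> ZEl ` {- int n..int n}}
        = (\<lambda>x. ZEl 1 \<otimes>\<^bsub>L 0\<^esub> x) ` ZEl ` {- int n..int n} \<union>
          (\<lambda>x. ZEl (- 1) \<otimes>\<^bsub>L 0\<^esub> x) ` ZEl ` {- int n..int n}" by blast
      thus ?thesis unfolding ball_Suc Suc i by (simp only: L_0_one image_image L_0_mult)
    qed
    also have "\<dots> = ZEl ` (insert 0 ((\<lambda>x. 1 + x) ` {- int n..int n} \<union> (\<lambda>x. - 1 + x) ` {- int n..int n}))"
      by (simp only: image_insert image_Un image_image)
    also have "insert 0 ((\<lambda>x. 1 + x) ` {- int n..int n} \<union> (\<lambda>x. - 1 + x) ` {- int n..int n})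
        = {- int (Suc n)..int (Suc n)}"
      by (simp only: image_add_atLeastAtMost) auto
    finally show ?case .
  }
qed

lemma card_ball_L_0: "card (ball (L 0) {ZEl 1} n) = 2 * n + 1"
  unfolding ball_L_0 by (subst card_image) (auto intro: inj_onI)

primrec std_gens :: "nat \<Rightarrow> W set" where
  "std_gens 0 = {ZEl 1}"
| "std_gens (Suc k) = wr_gens (L k) (std_gens k)"

lemma std_gens: "finite (std_gens k) \<and> std_gens k \<subseteq> carrier (L k) \<and> generate (L k) (std_gens k) = carrier (L k)"
proof (induction k)
  case 0
  interpret group "L 0" by (rule group_L_0)
  have S: "{ZEl 1} \<subseteq> carrier (L 0)" by (simp only: L_0_carrier) simp
  have "carrier (L 0) \<subseteq> generate (L 0) {ZEl 1}"
  proof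
    fix x assume "x \<in> carrier (L 0)"
    then obtain m where "x = ZEl m" by auto
    hence "x \<in> ball (L 0) {ZEl 1} (nat \<bar>m\<bar>)" unfolding ball_L_0 by (intro image_eqI[of _ _ m]) auto
    thus "x \<in> generate (L 0) {ZEl 1}" using ball_subset_generate by blast
  qed
  thus ?case using S generate_incl[OF S] by (simp only: std_gens.simps) blast
next
  case (Suc k)
  interpret lamp_group "L k" by (rule lamp_group.intro[OF group_L])
  show ?case unfolding L_Suc std_gens.simps
    using Suc finite_wr_gens wr_gens_subset generate_Wr by blast
qed

lemma exponent_bounds: "0 \<le> 1 - (1 - alpha) ^ k" "1 - (1 - alpha) ^ k < 1"
    "0 < k \<Longrightarrow> 0 < 1 - (1 - alpha) ^ k"
  using alpha_bounds by (simp_all add: power_le_one power_less_one_iff)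

text \<open>Each wreath product multiplies the distance of the exponent to 1 by 1 -
  \<alpha>.\<close>

lemma exponent_Suc: "1 - (1 - alpha) ^ Suc k = alpha + (1 - alpha) * (1 - (1 - alpha) ^ k)"
  by (simp add: algebra_simps)

lemma growth_std_gens:
  "upper_growth (L k) (std_gens k) (1 - (1 - alpha) ^ k) \<and>
   lower_growth (L k) (std_gens k) (1 - (1 - alpha) ^ k)"
proof (induction k)
  case 0
  have "real (card (ball (L 0) {ZEl 1} n)) \<le> exp (2 * ln (real n + 1) * real n powr 0)" for n
  proof (cases "n = 0")
    case False
    have "2 * real n + 1 \<le> (real n + 1) ^ 2" by (simp add: power2_eq_square algebra_simps)
    also have "\<dots> = exp (2 * ln (real n + 1))" by (subst power_eq_exp) simp_all
    finally show ?thesis unfolding card_ball_L_0 using False by simp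
  qed (unfold card_ball_L_0, simp)
  hence "upper_growth (L 0) {ZEl 1} 0" unfolding upper_growth_def
    by (intro exI[of _ 2] conjI allI) (simp_all only: zero_less_numeral)
  moreover have "exp (1 * ln (real n) * real n powr 0) \<le> real (card (ball (L 0) {ZEl 1} n))"
    if "n \<ge> 1" for n
    unfolding card_ball_L_0 using that by simp
  hence "lower_growth (L 0) {ZEl 1} 0" unfolding lower_growth_def
    by (intro exI[of _ 1] conjI allI impI) (simp_all only: zero_less_one)
  ultimately show ?case by (simp only: std_gens.simps power_0 diff_self simp_thms)
next
  case (Suc k)
  interpret lamp_group "L k" by (rule lamp_group.intro[OF group_L])
  have S: "finite (std_gens k)" "std_gens k \<subseteq> carrier (L k)" using std_gens[of k] by (simp_all only:)
  show ?case unfolding L_Suc std_gens.simps exponent_Suc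
    by (intro conjI upper_growth_Wr[OF S exponent_bounds(1,2)] lower_growth_Wr[OF S exponent_bounds(1,2)]
        Suc[THEN conjunct1] Suc[THEN conjunct2])
qed

section \<open>Passage to arbitrary generating sets\<close>

lemma growth_nat: "growth G S (real n) = real (card (ball G S n))"
  by (simp add: growth_def)

lemma growth_nat_mult: "growth G S (real m * real n) = real (card (ball G S (m * n)))"
  by (simp add: growth_def flip: of_nat_mult)

theorem theorem5p3:
  fixes k :: nat
  shows "(\<exists>S. finite S \<and> S \<subseteq> carrier (L k) \<and> generate (L k) S = carrier (L k))
       \<and> (\<forall>S. finite S \<and> S \<subseteq> carrier (L k) \<and> generate (L k) S = carrier (L k) \<longrightarrow>
              growth_equiv (growth (L k) S)
                (\<lambda>n. exp (ln n * n powr (1 - (1 - alpha) ^ k))))"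
proof (intro conjI allI impI)
  show "\<exists>S. finite S \<and> S \<subseteq> carrier (L k) \<and> generate (L k) S = carrier (L k)"
    using std_gens by blast
next
  fix S assume S: "finite S \<and> S \<subseteq> carrier (L k) \<and> generate (L k) S = carrier (L k)"
  interpret group "L k" by (rule group_L)
  let ?T = "std_gens k"
  let ?b = "1 - (1 - alpha) ^ k"
  let ?F = "\<lambda>n::real. exp (ln n * n powr ?b)"
  obtain q where q: "q \<ge> 1" "\<And>n. card (ball (L k) S n) \<le> card (ball (L k) ?T (q * n))"
    using change_generators[of ?T S] S std_gens[of k] by blast
  obtain p where p: "p \<ge> 1" "\<And>n. card (ball (L k) ?T n) \<le> card (ball (L k) S (p * n))"
    using change_generators[of S ?T] S std_gens[of k] by blast
  show "growth_equiv (growth (L k) S) ?F"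
  \<comment> \<open>A constant factor in front of log n can be moved into the argument only when the
    exponent is positive; at exponent 0 it would turn n into another power of n. Hence k = 0 relies
    on the exact ball size 2 n + 1 in the integers.\<close>
  proof (cases "k = 0")
    case True
    have F: "?F x = x" if "0 < x" for x using that True by simp
    have "growth (L k) S (real n) \<le> ?F (real (3 * q) * real n)" if n: "n \<ge> 1" for n
    proof -
      have "card (ball (L k) S n) \<le> 2 * (q * n) + 1"
        using q(2)[of n] True card_ball_L_0[of "q * n"] by simp
      also have "\<dots> \<le> 3 * q * n" using q(1) n by simp
      finally have "real (card (ball (L k) S n)) \<le> real (3 * q) * real n"
        by (simp only: of_nat_mult[symmetric] of_nat_le_iff)
      moreover have "?F (real (3 * q) * real n) = real (3 * q) * real n"
        using q(1) n by (intro F) simp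
      ultimately show ?thesis by (simp only: growth_nat)
    qed
    hence "preceq (growth (L k) S) ?F"
      unfolding preceq_def eventually_sequentially using q(1)
      by (intro exI[of _ "real (3 * q)"]) auto
    moreover have "?F (real n) \<le> growth (L k) S (real p * real n)" if n: "n \<ge> 1" for n
    proof -
      have "n \<le> card (ball (L k) S (p * n))"
        using p(2)[of n] True card_ball_L_0[of n] by simp
      moreover have "?F (real n) = real n" using n by (intro F) simp
      ultimately show ?thesis by (simp only: growth_nat_mult of_nat_le_iff)
    qed
    hence "preceq ?F (growth (L k) S)"
      unfolding preceq_def eventually_sequentially using p(1)
      by (intro exI[of _ "real p"]) auto
    ultimately show ?thesis by (simp only: growth_equiv_def)
  next
    case False
    hence b: "0 < ?b" using exponent_bounds(3) by simp
    obtain C where C: "0 < C"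
      "\<And>n. real (card (ball (L k) ?T n)) \<le> exp (C * ln (real n + 1) * real n powr ?b)"
      using growth_std_gens[of k] unfolding upper_growth_def by blast
    obtain c N where c: "0 < c"
      "\<And>n. n \<ge> N \<Longrightarrow> exp (c * ln (real n) * real n powr ?b) \<le> real (card (ball (L k) ?T n))"
      using growth_std_gens[of k] unfolding lower_growth_def by blast
    \<comment> \<open>With b the exponent, D^b \<ge> 2 C absorbs the constant \<open>C\<close> of
      the bound and the factor 2 from ln (x + 1) \<le> 2 ln (D x).\<close>
    define D where "D = max 2 ((2 * C) powr (1 / ?b))"
    have D: "2 \<le> D" "2 * C \<le> D powr ?b"
    proof -
      show "2 \<le> D" by (simp add: D_def)
      have "2 * C = ((2 * C) powr (1 / ?b)) powr ?b" using b C(1) by (simp add: powr_powr)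
      also have "\<dots> \<le> D powr ?b" using b by (intro powr_mono2) (simp_all add: D_def)
      finally show "2 * C \<le> D powr ?b" .
    qed
    have "growth (L k) S (real n) \<le> ?F (D * real q * real n)" if n: "n \<ge> 1" for n
    proof -
      define x where "x = real (q * n)"
      have x: "1 \<le> x" using mult_le_mono[OF q(1) n] by (simp add: x_def flip: of_nat_mult)
      have "x + 1 \<le> (D * x) ^ 2"
      proof -
        have "x + 1 \<le> 2 * x" using x by simp
        also have "\<dots> \<le> D * x" using x D(1) by (intro mult_right_mono) auto
        also have "\<dots> \<le> (D * x) ^ 2"
          using mult_mono[of 1 D 1 x] x D(1) by (intro self_le_power) auto
        finally show ?thesis .
      qed
      hence "ln (x + 1) \<le> ln ((D * x) ^ 2)" using x by (subst ln_le_cancel_iff) auto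
      also have "\<dots> = 2 * ln (D * x)" using x D(1) by (simp add: ln_realpow)
      finally have l: "ln (x + 1) \<le> 2 * ln (D * x)" .
      have "C * ln (x + 1) * x powr ?b \<le> C * (2 * ln (D * x)) * x powr ?b"
        using l C(1) by (intro mult_right_mono mult_left_mono) auto
      also have "\<dots> = ln (D * x) * (2 * C * x powr ?b)" by simp
      also have "\<dots> \<le> ln (D * x) * (D powr ?b * x powr ?b)"
        using D x mult_mono[of 1 D 1 x] by (intro mult_left_mono mult_right_mono) auto
      also have "\<dots> = ln (D * x) * (D * x) powr ?b" using D x by (simp add: powr_mult)
      finally have "C * ln (x + 1) * x powr ?b \<le> ln (D * x) * (D * x) powr ?b" .
      moreover have "growth (L k) S (real n) \<le> exp (C * ln (x + 1) * x powr ?b)"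
        using q(2)[of n] C(2)[of "q * n"] unfolding growth_nat x_def by (meson of_nat_le_iff order_trans)
      moreover have "D * real q * real n = D * x" by (simp add: x_def)
      ultimately show ?thesis by (simp only: exp_le_cancel_iff) (meson exp_le_cancel_iff order_trans)
    qed
    moreover have "0 < D * real q" using D(1) q(1) by simp
    ultimately have "preceq (growth (L k) S) ?F"
      unfolding preceq_def eventually_sequentially by blast
    moreover have "preceq ?F (growth (L k) S)"
    proof -
      \<comment> \<open>Chosen with E^b \<ge> 1 / c, and as an integer so that E n is again the
        radius of a ball.\<close>
      define E where "E = nat \<lceil>max 1 ((1 / c) powr (1 / ?b))\<rceil>"
      have E: "1 \<le> E" "(1 / c) powr (1 / ?b) \<le> real E" unfolding E_def by linarith+
      have cE: "1 \<le> c * real E powr ?b"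
      proof -
        have "1 / c = ((1 / c) powr (1 / ?b)) powr ?b" using b c(1) by (simp add: powr_powr)
        also have "\<dots> \<le> real E powr ?b" using b E(2) by (intro powr_mono2) simp_all
        finally show ?thesis using c(1) by (simp add: field_simps)
      qed
      have "?F (real n) \<le> growth (L k) S (real (p * E) * real n)" if n: "n \<ge> max 1 N" for n
      proof -
        have En: "n \<le> E * n" using E(1) by simp
        have "ln (real n) * real n powr ?b \<le> ln (real (E * n)) * (c * real E powr ?b * real n powr ?b)"
        proof (rule mult_mono)
          have "real n \<le> real (E * n)" using En by (simp only: of_nat_le_iff)
          thus "ln (real n) \<le> ln (real (E * n))" using n by (subst ln_le_cancel_iff) linarith+
          show "real n powr ?b \<le> c * real E powr ?b * real n powr ?b"
            using mult_right_mono[OF cE, of "real n powr ?b"] by simp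
          show "0 \<le> ln (real (E * n))" using n E(1) by (intro ln_ge_zero) (simp flip: of_nat_mult)
        qed simp
        also have "\<dots> = c * ln (real (E * n)) * real (E * n) powr ?b" by (simp add: powr_mult)
        finally have "?F (real n) \<le> exp (c * ln (real (E * n)) * real (E * n) powr ?b)"
          by (simp only: exp_le_cancel_iff)
        also have "\<dots> \<le> real (card (ball (L k) ?T (E * n)))" 
          using n by (intro c(2) order_trans[OF _ En]) simp
        also have "\<dots> \<le> real (card (ball (L k) S (p * (E * n))))" using p(2) by (simp only: of_nat_le_iff)
        finally show ?thesis by (simp only: growth_nat_mult mult.assoc)
      qed
      moreover have "0 < real (p * E)" using p(1) E(1) by simp
      ultimately show ?thesis unfolding preceq_def eventually_sequentially by blast
    qed
    ultimately show ?thesis by (simp only: growth_equiv_def)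
  qed
qed

end
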